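(* Let $G$ be a finite abelian group of order $N$, let $S\subseteq G\setminus\{0\}$ satisfy $S=-S$, and let $K$ be a field with $\operatorname{char}(K)=p\mid N$; write $N=p^aM$ with $p\nmid M$. Let $G'$ be the prime-to-$p$ quotient of $G$ (of order $M$) and $\pi:G\to G'$ the quotient map. For $s'\in G'$ put $w(s')=|\{s\in S:\pi(s)=s'\}|$. Then $$\mathcal{A}_K(\mathrm{Cay}(G,S))\big/\mathrm{J}(\mathcal{A}_K(\mathrm{Cay}(G,S)))\;\cong\;K[x]\big/(m_{G,S,K}^{\mathrm{red}})$$ as $K$-algebras, where $m_{G,S,K}^{\mathrm{red}}$ is the squarefree part of $m_{G,S,K}$; moreover $m_{G,S,K}^{\mathrm{red}}$ equals the minimal polynomial over $K$ of the weighted Cayley matrix on $G'$ determined by $w$.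
   Context: $G$ is written additively. $\mathrm{Cay}(G,S)$ is the graph with vertex set $G$ and edges $\{g,g+s\}$ for $g\in G$, $s\in S$; its adjacency matrix $A$, with rows and columns indexed by $G$, has $A_{g,h}=1$ if $h-g\in S$ and $0$ otherwise, regarded as a matrix over $K$. $\mathcal{A}_K(\mathrm{Cay}(G,S))=K[A]\subseteq M_N(K)$ is the algebra of polynomials in $A$, and $m_{G,S,K}$ is the minimal polynomial of $A$ over $K$. $\mathrm{J}(R)$ is the Jacobson radical of $R$. The squarefree part of a monic polynomial is the product of its distinct monic irreducible factors over $K$. The prime-to-$p$ quotient of $G$ is $G$ modulo its Sylow $p$-subgroup. The weighted Cayley matrix on $G'$ is the $M\times M$ matrix over $K$ indexed by $G'$ with $(g',h')$ entry $w(h'-g')$ (the weight $w(0)$ may be nonzero). *)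

theory Defs
  imports
    "HOL-Computational_Algebra.Polynomial"
    "HOL-Computational_Algebra.Factorial_Ring"
    "HOL-Algebra.QuotRing"
    "Jordan_Normal_Form.Matrix"
begin

section \<open>Algebras over a field\<close>

text \<open>
  The field \<open>K\<close> is a type \<open>'k\<close> of class \<open>field\<close>; a \<open>K\<close>-algebra is a record of type
  \<open>('k, 'a) module\<close>, which carries a ring structure together with a scalar multiplication.
\<close>

definition poly_algebra :: "('k::field, 'k poly) module" where
  "poly_algebra = \<lparr>carrier = UNIV, mult = (*), one = 1, zero = 0, add = (+),
     smult = Polynomial.smult\<rparr>"

definition alg_eval :: "('k::field, 'a, 'm) module_scheme \<Rightarrow> 'k poly \<Rightarrow> 'a \<Rightarrow> 'a" where
  "alg_eval B f x =
     (\<Oplus>\<^bsub>B\<^esub>i\<in>{..degree f}. Polynomial.coeff f i \<odot>\<^bsub>B\<^esub> (x [^]\<^bsub>B\<^esub> i))"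

text \<open>The subalgebra \<open>K[x]\<close> of \<open>B\<close>, for an element \<open>x\<close> of \<open>B\<close>.\<close>

definition alg_adjoin :: "('k::field, 'a, 'm) module_scheme \<Rightarrow> 'a \<Rightarrow> ('k, 'a, 'm) module_scheme" where
  "alg_adjoin B x = B\<lparr>carrier := range (\<lambda>f. alg_eval B f x)\<rparr>"

text \<open>The scalar multiplication on cosets is written in the style of \<^const>\<open>rcoset_mult\<close>.\<close>

definition alg_quotient :: "('k, 'a, 'm) module_scheme \<Rightarrow> 'a set \<Rightarrow> ('k, 'a set) module" where
  "alg_quotient B I = ring.extend (B Quot I)
     \<lparr>smult = (\<lambda>c X. \<Union>x\<in>X. I +>\<^bsub>B\<^esub> (c \<odot>\<^bsub>B\<^esub> x))\<rparr>"

definition alg_isomorphic ::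
    "('k::field, 'a, 'm) module_scheme \<Rightarrow> ('k, 'b, 'n) module_scheme \<Rightarrow> bool" where
  "alg_isomorphic B C \<longleftrightarrow>
     (\<exists>h\<in>ring_iso B C. \<forall>c. \<forall>x\<in>carrier B. h (c \<odot>\<^bsub>B\<^esub> x) = c \<odot>\<^bsub>C\<^esub> h x)"

text \<open>
  The Jacobson radical of a commutative ring, where maximal one-sided ideals
  are the same as maximal ideals.
\<close>

definition jacobson_radical :: "('a, 'm) ring_scheme \<Rightarrow> 'a set" where
  "jacobson_radical R = carrier R \<inter> \<Inter>{I. maximalideal I R}"

section \<open>Minimal polynomials and squarefree parts\<close>

abbreviation mat_algebra :: "nat \<Rightarrow> ('k::field, 'k mat) module" where
  "mat_algebra n \<equiv> module_mat TYPE('k) n n"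

text \<open>The monic polynomial of least degree that annihilates the \<open>n\<times>n\<close> matrix \<open>A\<close>.\<close>

definition min_poly_mat :: "nat \<Rightarrow> 'k::field mat \<Rightarrow> 'k poly" where
  "min_poly_mat n A = (THE m. lead_coeff m = 1 \<and> alg_eval (mat_algebra n) m A = 0\<^sub>m n n \<and>
     (\<forall>f. f \<noteq> 0 \<and> alg_eval (mat_algebra n) f A = 0\<^sub>m n n \<longrightarrow> degree m \<le> degree f))"

definition squarefree_part :: "'k::field poly \<Rightarrow> 'k poly" where
  "squarefree_part f = \<Prod>{q. lead_coeff q = 1 \<and> irreducible q \<and> q dvd f}"

section \<open>Cayley graphs and Cayley matrices\<close>

text \<open>
  Groups are multiplicative here, so \<open>g + s\<close> becomes \<open>g \<otimes> s\<close> and \<open>h - g\<close> becomes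
  \<open>h \<otimes> inv g\<close>. Matrices indexed by a finite group of order \<open>n\<close> are represented through an
  enumeration \<open>e\<close> of the group by \<open>{..<n}\<close>.
\<close>

definition cayley_edges :: "('g, 'm) monoid_scheme \<Rightarrow> 'g set \<Rightarrow> 'g set set" where
  "cayley_edges G S = {{g, g \<otimes>\<^bsub>G\<^esub> s} | g s. g \<in> carrier G \<and> s \<in> S}"

definition weighted_cayley_mat ::
    "('g, 'm) monoid_scheme \<Rightarrow> nat \<Rightarrow> (nat \<Rightarrow> 'g) \<Rightarrow> ('g \<Rightarrow> 'k) \<Rightarrow> 'k mat" where
  "weighted_cayley_mat G n e w = mat n n (\<lambda>(i, j). w (e j \<otimes>\<^bsub>G\<^esub> inv\<^bsub>G\<^esub> (e i)))"

definition cayley_adj_mat ::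
    "('g, 'm) monoid_scheme \<Rightarrow> nat \<Rightarrow> (nat \<Rightarrow> 'g) \<Rightarrow> 'g set \<Rightarrow> 'k::field mat" where
  "cayley_adj_mat G n e S =
     mat n n (\<lambda>(i, j). if e j \<otimes>\<^bsub>G\<^esub> inv\<^bsub>G\<^esub> (e i) \<in> S then 1 else 0)"

lemma (in comm_group) cayley_edges_iff:
  assumes "S \<subseteq> carrier G" "m_inv G ` S = S" "g \<in> carrier G" "h \<in> carrier G"
  shows "{g, h} \<in> cayley_edges G S \<longleftrightarrow> h \<otimes> inv g \<in> S"
proof
  assume "{g, h} \<in> cayley_edges G S"
  then obtain x s where x: "x \<in> carrier G" "s \<in> S" and eq: "{g, h} = {x, x \<otimes> s}"
    unfolding cayley_edges_def by blast
  have s: "s \<in> carrier G" using x assms by blast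
  from eq consider "g = x" "h = x \<otimes> s" | "h = x" "g = x \<otimes> s"
    by (auto simp: doubleton_eq_iff)
  then show "h \<otimes> inv g \<in> S"
  proof cases
    case 1
    then have "h \<otimes> inv g = s" using x s by (simp add: m_comm[of x s] m_assoc)
    then show ?thesis using x by simp
  next
    case 2
    then have "h \<otimes> inv g = inv s" using x s by (simp add: inv_mult m_assoc[symmetric])
    then show ?thesis using x assms(2) by blast
  qed
next
  assume a: "h \<otimes> inv g \<in> S"
  have "g \<otimes> (h \<otimes> inv g) = h" using assms by (simp add: m_comm[of h "inv g"] m_assoc[symmetric])
  then show "{g, h} \<in> cayley_edges G S"
    unfolding cayley_edges_def using a assms(3) by force
qed

lemma (in comm_group) cayley_adj_mat_edge:
  assumes "S \<subseteq> carrier G" "m_inv G ` S = S" "bij_betw e {..<n} (carrier G)" "i < n" "j < n"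
  shows "cayley_adj_mat G n e S $$ (i, j) = (if {e i, e j} \<in> cayley_edges G S then 1 else 0)"
proof -
  have "e i \<in> carrier G" "e j \<in> carrier G"
    using assms by (auto dest: bij_betw_apply)
  then show ?thesis
    using assms by (simp add: cayley_adj_mat_def cayley_edges_iff)
qed

definition cayley_algebra ::
    "('g, 'm) monoid_scheme \<Rightarrow> nat \<Rightarrow> (nat \<Rightarrow> 'g) \<Rightarrow> 'g set \<Rightarrow> ('k::field, 'k mat) module" where
  "cayley_algebra G n e S = alg_adjoin (mat_algebra n) (cayley_adj_mat G n e S)"

text \<open>The weight of a coset \<open>x\<close> of \<open>P\<close>: the number of elements of \<open>S\<close> lying over \<open>x\<close>.\<close>

definition coset_weight :: "('g, 'm) monoid_scheme \<Rightarrow> 'g set \<Rightarrow> 'g set \<Rightarrow> 'g set \<Rightarrow> nat" where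
  "coset_weight G P S x = card {s \<in> S. P #>\<^bsub>G\<^esub> s = x}"

end

theory Submission
  imports
    Defs
    "HOL-Computational_Algebra.Polynomial_Factorial"
    "HOL-Algebra.Multiplicative_Group"
begin

text \<open>
  A polynomial lies in every maximal ideal of \<open>K[A] \<cong> K[x]/(m)\<close> iff every irreducible factor of
  \<open>m\<close> divides it, so the Jacobson radical is generated by the squarefree part of \<open>m\<close>, which gives
  the isomorphism. For the second claim, \<open>f(A)\<close> and \<open>f(B)\<close>, for \<open>B\<close> the weighted matrix on the
  quotient, are the convolution matrices of an element \<open>v\<close> of \<open>K[G]\<close> and of its image in \<open>K[G']\<close>. By
  the Frobenius map \<open>v ^ p ^ j\<close> is the sum of \<open>(v\<^sub>g ^ p ^ j) (g ^ p ^ j)\<close>, and for \<open>j \<ge> a\<close> two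
  elements of \<open>G\<close> have the same power \<open>p ^ j\<close> iff they agree in \<open>G'\<close>. Hence \<open>v ^ p ^ j = 0\<close> iff
  the image of \<open>v\<close> vanishes: \<open>f(B) = 0\<close> iff \<open>f(A)\<close> is nilpotent iff the squarefree part of \<open>m\<close>
  divides \<open>f\<close>.
\<close>

section \<open>Squarefree parts of polynomials\<close>

lemma irreducible_monic_associate:
  fixes q :: "'k::field poly"
  assumes "irreducible q"
  obtains q' where "lead_coeff q' = 1" "irreducible q'" "q' dvd q" "q dvd q'"
proof
  let ?c = "inverse (lead_coeff q)"
  have c: "?c \<noteq> 0" using assms by auto
  show "lead_coeff (Polynomial.smult ?c q) = 1" using c by simp
  show 1: "Polynomial.smult ?c q dvd q" using c by (simp add: smult_dvd_iff)
  show 2: "q dvd Polynomial.smult ?c q" by (rule dvd_smult) simp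
  have "Polynomial.smult ?c q = [:?c:] * q" by simp
  moreover have "is_unit [:?c:]" using c by (simp add: is_unit_pCons_iff)
  ultimately show "irreducible (Polynomial.smult ?c q)"
    using assms by (metis irreducible_mult_unit_left)
qed

lemma monic_poly_dvd_antisym:
  fixes f g :: "'k::field poly"
  assumes "lead_coeff f = 1" "lead_coeff g = 1" "f dvd g" "g dvd f"
  shows "f = g"
proof -
  obtain c where c: "g = f * c" using assms by auto
  then have "degree c = 0" using assms
    by (metis add.right_neutral add_left_cancel degree_mult_eq dvd_imp_degree_le lead_coeff_1
        le_antisym leading_coeff_0_iff mult_zero_left mult_zero_right zero_neq_one)
  then obtain a where "c = [:a:]" by (metis degree_0_id)
  then show ?thesis using c assms by (auto split: if_splits)
qed

text \<open>Over an arbitrary field the prime factors are normalized by dividing by the leading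
  coefficient. Keeping only mutual divisibility with \<open>f\<close> discards the remaining unit
  factor.\<close>

lemma poly_prime_factorization:
  fixes f :: "'k::field poly"
  assumes "f \<noteq> 0"
  obtains Q where "\<And>q. q \<in># Q \<Longrightarrow> prime_elem q" "f dvd prod_mset Q" "prod_mset Q dvd f"
proof
  note * = field_poly_prod_mset_prime_factorization[OF assms]
  show "prime_elem q" if "q \<in># factorial_semiring.prime_factorization 0 (*) 1
           (\<lambda>p. Polynomial.smult (inverse (lead_coeff p)) p) f" for q
    using that by (rule field_poly_in_prime_factorization_imp_prime)
  show "f dvd prod_mset (factorial_semiring.prime_factorization 0 (*) 1
           (\<lambda>p. Polynomial.smult (inverse (lead_coeff p)) p) f)"
    unfolding * by (rule dvd_smult) simp
  show "prod_mset (factorial_semiring.prime_factorization 0 (*) 1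
           (\<lambda>p. Polynomial.smult (inverse (lead_coeff p)) p) f) dvd f"
    unfolding * using assms by (simp add: smult_dvd_iff)
qed

lemma irreducible_dvd_irreducible_sym:
  fixes q r :: "'k::field poly"
  assumes "irreducible q" "irreducible r" "q dvd r"
  shows "r dvd q"
  using assms by (metis irreducible_altdef irreducible_def)

text \<open>Each irreducible divisor divides some member of the finite multiset of prime factors,
  and two monic irreducibles dividing the same prime are equal. Choosing such a prime is therefore
  injective. Finiteness makes the product in \<open>squarefree_part\<close> a genuine one.\<close>

lemma finite_monic_irreducible_divisors:
  fixes f :: "'k::field poly"
  assumes "f \<noteq> 0"
  shows "finite {q. lead_coeff q = 1 \<and> irreducible q \<and> q dvd f}"
proof -
  obtain Q where Q: "\<And>q. q \<in># Q \<Longrightarrow> prime_elem q" "f dvd prod_mset Q" "prod_mset Q dvd f"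
    using poly_prime_factorization[OF assms] by blast
  have "\<exists>r \<in># Q. q dvd r" if "irreducible q" "q dvd f" for q
    by (meson that Q(2) dvd_trans field_poly_irreducible_imp_prime prime_elem_dvd_prod_msetE)
  then obtain s where s: "\<And>q. irreducible q \<Longrightarrow> q dvd f \<Longrightarrow> s q \<in># Q \<and> q dvd s q" by metis
  show ?thesis
  proof (rule inj_on_finite)
    show "s ` {q. lead_coeff q = 1 \<and> irreducible q \<and> q dvd f} \<subseteq> set_mset Q" using s by auto
    show "inj_on s {q. lead_coeff q = 1 \<and> irreducible q \<and> q dvd f}"
    proof (rule inj_onI)
      fix q r
      assume q: "q \<in> {q. lead_coeff q = 1 \<and> irreducible q \<and> q dvd f}"
        and r: "r \<in> {q. lead_coeff q = 1 \<and> irreducible q \<and> q dvd f}" and eq: "s q = s r"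
      have "irreducible (s q)" using q s Q(1) prime_elem_imp_irreducible by blast
      then show "q = r"
        using q r s eq by (intro monic_poly_dvd_antisym)
          (metis (mono_tags, lifting) dvd_trans irreducible_dvd_irreducible_sym mem_Collect_eq)+
    qed
  qed simp
qed

text \<open>For \<open>f = 0\<close> the index set consists of all monic irreducibles; the product
  over this infinite set has the default value 1, which is monic as well.\<close>

lemma lead_coeff_squarefree_part: "lead_coeff (squarefree_part f) = 1"
  unfolding squarefree_part_def
  by (simp add: lead_coeff_prod prod.neutral)

text \<open>Distinct monic irreducibles are pairwise coprime, so their product divides whatever each
  of them divides. Later divisibility arguments use this criterion instead of the product
  itself.\<close>

lemma squarefree_part_dvd_iff:
  fixes f g :: "'k::field poly"
  assumes "f \<noteq> 0"
  shows "squarefree_part f dvd g \<longleftrightarrow> (\<forall>q. irreducible q \<and> q dvd f \<longrightarrow> q dvd g)"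
proof -
  \<comment> \<open>Induction on the set of factors: with \<open>g = \<Prod>Q * h\<close>, the new
    prime \<open>q\<close> divides no member of \<open>Q\<close>, so it must divide
    \<open>h\<close>.\<close>
  have *: "(\<Prod>Q) dvd g" if "finite Q" "\<forall>q\<in>Q. lead_coeff q = 1 \<and> irreducible q \<and> q dvd g" for Q
    using that
  proof (induction Q)
    case (insert q Q)
    then obtain h where h: "g = \<Prod>Q * h" by auto
    have q: "prime_elem q" using insert.prems by (auto intro: field_poly_irreducible_imp_prime)
    have "\<not> q dvd \<Prod>Q"
    proof
      assume "q dvd \<Prod>Q"
      then obtain r where r: "r \<in> Q" "q dvd r"
        using q insert.hyps unfolding prod_unfold_prod_mset
        by (auto elim!: prime_elem_dvd_prod_msetE)
      then have "q = r" using insert.prems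
        by (intro monic_poly_dvd_antisym) (auto intro: irreducible_dvd_irreducible_sym)
      then show False using r insert.hyps by simp
    qed
    then have "q dvd h" using q insert.prems h by (auto simp: prime_elem_dvd_mult_iff)
    then show ?case using insert.hyps h by (simp add: mult.commute mult_dvd_mono)
  qed simp
  show ?thesis
  proof
    assume "squarefree_part f dvd g"
    moreover have "q dvd squarefree_part f" if q: "irreducible q" "q dvd f" for q
    proof -
      obtain q' where "lead_coeff q' = 1" "irreducible q'" "q' dvd q" "q dvd q'"
        using irreducible_monic_associate[OF q(1)] by blast
      moreover have "q' dvd squarefree_part f"
        unfolding squarefree_part_def
        using calculation q(2)
        by (intro dvd_prodI finite_monic_irreducible_divisors assms) (auto intro: dvd_trans)
      ultimately show ?thesis by (blast intro: dvd_trans)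
    qed
    ultimately show "\<forall>q. irreducible q \<and> q dvd f \<longrightarrow> q dvd g" by (blast intro: dvd_trans)
  next
    assume "\<forall>q. irreducible q \<and> q dvd f \<longrightarrow> q dvd g"
    then show "squarefree_part f dvd g"
      unfolding squarefree_part_def by (intro * finite_monic_irreducible_divisors assms) auto
  qed
qed

lemma squarefree_part_dvd:
  fixes f :: "'k::field poly"
  assumes "f \<noteq> 0"
  shows "squarefree_part f dvd f"
  using squarefree_part_dvd_iff[OF assms] by blast

text \<open>Every prime factor of \<open>f\<close> divides the squarefree part, so the number of
  prime factors counted with multiplicity is a suitable exponent. This makes the squarefree part
  nilpotent modulo \<open>f\<close>.\<close>

lemma dvd_squarefree_part_power:
  fixes f :: "'k::field poly"
  assumes "f \<noteq> 0"
  shows "\<exists>k. f dvd squarefree_part f ^ k"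
proof -
  obtain Q where Q: "\<And>q. q \<in># Q \<Longrightarrow> prime_elem q" "f dvd prod_mset Q" "prod_mset Q dvd f"
    using poly_prime_factorization[OF assms] by blast
  have "q dvd squarefree_part f" if "q \<in># Q" for q
  proof -
    have "irreducible q" using Q(1)[OF that] by (rule prime_elem_imp_irreducible)
    moreover have "q dvd f" using that Q(3) dvd_prod_mset dvd_trans by blast
    ultimately show ?thesis using squarefree_part_dvd_iff[OF assms, of "squarefree_part f"] by simp
  qed
  then have "prod_mset Q dvd squarefree_part f ^ size Q"
    by (induction Q) (auto intro: mult_dvd_mono)
  then show ?thesis using Q(2) dvd_trans by blast
qed

section \<open>The Frobenius map on commuting elements of a ring\<close>

text \<open>Commutation is assumed only for the two elements, because the formula is meant for the
  full matrix algebra, which is not commutative.\<close>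

lemma (in ring) binomial_commuting:
  assumes x: "x \<in> carrier R" and y: "y \<in> carrier R" and xy: "x \<otimes> y = y \<otimes> x"
  shows "(x \<oplus> y) [^] n = (\<Oplus>k\<in>{..n}. [(n choose k)] \<cdot> (x [^] k \<otimes> y [^] (n - k)))"
proof (induction n)
  case 0
  then show ?case using x y by (simp add: Pi_def)
next
  case (Suc n)
  define t where "t k l = x [^] k \<otimes> y [^] l" for k l :: nat
  have t: "t k l \<in> carrier R" for k l using x y by (simp add: t_def)
  have ty: "t k l \<otimes> y = t k (Suc l)" for k l using x y by (simp add: t_def m_assoc)
  have yx: "y [^] l \<otimes> x = x \<otimes> y [^] l" for l :: nat
    using x y xy by (induction l) (simp_all add: m_assoc, metis m_assoc nat_pow_closed)
  have tx: "t k l \<otimes> x = t (Suc k) l" for k l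
    using x y yx[of l] by (simp add: t_def m_assoc[symmetric]) (simp add: m_assoc)
  let ?f = "\<lambda>k. [(n choose k)] \<cdot> t k (Suc n - k)"
  \<comment> \<open>The coefficient is \<open>n choose (k - 1)\<close>, with value 0 at
    \<open>k = 0\<close>. Both sums then run over \<open>{..Suc n}\<close>, and Pascal's rule
    applies term by term.\<close>
  let ?g = "\<lambda>k. [(case k of 0 \<Rightarrow> 0 | Suc k \<Rightarrow> n choose k)] \<cdot> t k (Suc n - k)"
  have "(x \<oplus> y) [^] Suc n = (\<Oplus>k\<in>{..n}. [(n choose k)] \<cdot> t k (n - k)) \<otimes> (x \<oplus> y)"
    using Suc by (simp add: t_def)
  also have "\<dots> = (\<Oplus>k\<in>{..n}. [(n choose k)] \<cdot> t k (n - k)) \<otimes> x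
      \<oplus> (\<Oplus>k\<in>{..n}. [(n choose k)] \<cdot> t k (n - k)) \<otimes> y"
    using x y t by (intro r_distr finsum_closed) auto
  also have "(\<Oplus>k\<in>{..n}. [(n choose k)] \<cdot> t k (n - k)) \<otimes> x = (\<Oplus>k\<in>{..n}. ?g (Suc k))"
    using x t by (simp add: finsum_ldistr Pi_def add_pow_ldistr tx)
  also have "\<dots> = (\<Oplus>k\<in>{..Suc n}. ?g k)"
    using t by (subst finsum_Suc2) (auto simp: Pi_def)
  also have "(\<Oplus>k\<in>{..n}. [(n choose k)] \<cdot> t k (n - k)) \<otimes> y = (\<Oplus>k\<in>{..n}. ?f k)"
    using y t by (simp add: finsum_ldistr Pi_def add_pow_ldistr ty)
       (intro finsum_cong', auto simp: Suc_diff_le t)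
  also have "\<dots> = (\<Oplus>k\<in>{..Suc n}. ?f k)"
    using t by (simp add: Pi_def binomial_eq_0)
  also have "(\<Oplus>k\<in>{..Suc n}. ?g k) \<oplus> (\<Oplus>k\<in>{..Suc n}. ?f k) = (\<Oplus>k\<in>{..Suc n}. ?g k \<oplus> ?f k)"
    using t by (intro finsum_addf[symmetric]) auto
  also have "\<dots> = (\<Oplus>k\<in>{..Suc n}. [(Suc n choose k)] \<cdot> t k (Suc n - k))"
    using t by (intro finsum_cong') (auto simp: add.nat_pow_mult split: nat.split)
  finally show ?case by (simp only: t_def)
qed

text \<open>The binomial coefficients strictly between the two ends are divisible by
  \<open>p\<close>, and multiples of \<open>p\<close> annihilate the ring.\<close>

lemma (in ring) frobenius_add:
  assumes p: "Factorial_Ring.prime p" "[p] \<cdot> \<one> = \<zero>"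
    and x: "x \<in> carrier R" and y: "y \<in> carrier R" and xy: "x \<otimes> y = y \<otimes> x"
  shows "(x \<oplus> y) [^] p = x [^] p \<oplus> y [^] (p::nat)"
proof -
  let ?f = "\<lambda>k. [(p choose k)] \<cdot> (x [^] k \<otimes> y [^] (p - k))"
  have p0: "p > 0" using p prime_gt_0_nat by simp
  have kill: "[(p * k)] \<cdot> z = \<zero>" if "z \<in> carrier R" for k :: nat and z
  proof -
    have "[p] \<cdot> z = ([p] \<cdot> \<one>) \<otimes> z" using that by (simp add: add_pow_ldistr)
    then have "[p] \<cdot> z = \<zero>" using p that by simp
    then show ?thesis using that by (simp add: add.nat_pow_pow[symmetric])
  qed
  have "(x \<oplus> y) [^] p = (\<Oplus>k\<in>{..p}. ?f k)" using x y xy by (rule binomial_commuting)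
  also have "\<dots> = (\<Oplus>k\<in>{0, p}. ?f k)"
  proof (rule add.finprod_mono_neutral_cong_right)
    fix k assume "k \<in> {..p} - {0, p}"
    then have "p dvd (p choose k)" using p by (intro dvd_choose_prime) auto
    then show "?f k = \<zero>" using x y by (auto simp: kill elim!: dvdE)
  qed (use x y in auto)
  also have "\<dots> = x [^] p \<oplus> y [^] p" using x y p0 by (simp add: a_comm)
  finally show ?thesis .
qed

lemma (in ring) frobenius_power_add:
  assumes p: "Factorial_Ring.prime p" "[p] \<cdot> \<one> = \<zero>"
    and x: "x \<in> carrier R" and y: "y \<in> carrier R" and xy: "x \<otimes> y = y \<otimes> x"
  shows "(x \<oplus> y) [^] (p ^ j) = x [^] (p ^ j) \<oplus> y [^] (p ^ j :: nat)"
proof (induction j)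
  case (Suc j)
  have c: "x [^] k \<otimes> y [^] k = y [^] k \<otimes> x [^] k" for k :: nat
  proof -
    have *: "u [^] k \<otimes> v = v \<otimes> u [^] k"
      if "u \<in> carrier R" "v \<in> carrier R" "u \<otimes> v = v \<otimes> u" for u v and k :: nat
      using that by (induction k) (simp_all add: m_assoc, metis m_assoc nat_pow_closed)
    show ?thesis using x y xy *[of y x k] *[of x "y [^] k" k] by simp
  qed
  have "(x \<oplus> y) [^] (p ^ Suc j) = ((x \<oplus> y) [^] (p ^ j)) [^] p"
    using x y by (simp add: nat_pow_pow mult.commute)
  also have "\<dots> = x [^] (p ^ Suc j) \<oplus> y [^] (p ^ Suc j)"
    using x y c p by (simp add: Suc frobenius_add nat_pow_pow mult.commute)
  finally show ?case .
qed (use x y in simp)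

lemma (in ring) frobenius_power_finsum:
  assumes p: "Factorial_Ring.prime p" "[p] \<cdot> \<one> = \<zero>" and fin: "finite I"
    and f: "f \<in> I \<rightarrow> carrier R"
    and comm: "\<And>i k. i \<in> I \<Longrightarrow> k \<in> I \<Longrightarrow> f i \<otimes> f k = f k \<otimes> f i"
  shows "(\<Oplus>i\<in>I. f i) [^] (p ^ j) = (\<Oplus>i\<in>I. f i [^] (p ^ j :: nat))"
  using fin f comm
proof (induction I)
  case empty
  \<comment> \<open>A positive exponent is essential for the empty sum, since the zeroth power of
    zero is one.\<close>
  have "p ^ j > 0" using p prime_gt_0_nat by simp
  then show ?case by (simp add: nat_pow_zero)
next
  case (insert i I)
  have "f i \<otimes> (\<Oplus>i\<in>I. f i) = (\<Oplus>i\<in>I. f i) \<otimes> f i"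
    using insert.prems insert.hyps(1)
    by (simp add: finsum_rdistr finsum_ldistr Pi_def) (intro finsum_cong', auto)
  then show ?case
    using insert frobenius_power_add[OF p, of "f i" "\<Oplus>i\<in>I. f i" j] by (simp add: Pi_def)
qed

section \<open>Evaluation of polynomials at matrices\<close>

lemma zero_smult_mat: "(0 :: 'a::mult_zero) \<cdot>\<^sub>m A = 0\<^sub>m (dim_row A) (dim_col A)"
  by (rule eq_matI) auto

lemma one_smult_mat: "(1 :: 'a::monoid_mult) \<cdot>\<^sub>m A = A"
  by (rule eq_matI) auto

lemma smult_smult_mat: "(a :: 'a::semigroup_mult) \<cdot>\<^sub>m (b \<cdot>\<^sub>m A) = (a * b) \<cdot>\<^sub>m A"
  by (rule eq_matI) (auto simp: mult.assoc)

lemma ring_mat_algebra: "ring (mat_algebra n :: ('k::field, 'k mat) module)"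
  by (unfold_locales, insert add_inv_exists_mat, auto simp: module_mat_def algebra_simps Units_def)

lemma mat_algebra_nat_pow:
  assumes "A \<in> carrier_mat n n"
  shows "A [^]\<^bsub>mat_algebra n\<^esub> (k::nat) = A ^\<^sub>m k"
  using assms by (induction k) (simp_all add: nat_pow_def module_mat_simps)

text \<open>A free upper bound is convenient because the degree of \<open>pCons a f\<close> is
  smaller than \<open>Suc (degree f)\<close> when \<open>f = 0\<close>.\<close>

lemma alg_eval_upto:
  assumes A: "A \<in> carrier_mat n n" and "degree f \<le> d"
  shows "alg_eval (mat_algebra n) f A =
    (\<Oplus>\<^bsub>mat_algebra n\<^esub>i\<in>{..d}. Polynomial.coeff f i \<cdot>\<^sub>m A ^\<^sub>m i)"
proof -
  interpret B: ring "mat_algebra n :: ('a, 'a mat) module" by (rule ring_mat_algebra)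
  show ?thesis
    unfolding alg_eval_def mat_algebra_nat_pow[OF A]
    by (rule B.add.finprod_mono_neutral_cong_left)
      (use assms in \<open>auto simp: module_mat_simps coeff_eq_0\<close>)
qed

lemma alg_eval_closed:
  assumes "A \<in> carrier_mat n n"
  shows "alg_eval (mat_algebra n) f A \<in> carrier_mat n n"
proof -
  interpret B: ring "mat_algebra n :: ('a, 'a mat) module" by (rule ring_mat_algebra)
  have "alg_eval (mat_algebra n) f A \<in> carrier (mat_algebra n)"
    unfolding alg_eval_upto[OF assms order_refl]
    using assms by (intro B.finsum_closed) (auto simp: module_mat_simps)
  then show ?thesis by (simp add: module_mat_simps)
qed

lemma alg_eval_0: "alg_eval (mat_algebra n) 0 A = 0\<^sub>m n n"
proof -
  interpret B: ring "mat_algebra n :: ('a, 'a mat) module" by (rule ring_mat_algebra)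
  show ?thesis by (simp add: alg_eval_def module_mat_simps zero_smult_mat)
qed

text \<open>Horner's rule. The homomorphism properties of evaluation follow from it by induction on
  the coefficients.\<close>

lemma alg_eval_pCons:
  assumes A: "A \<in> carrier_mat n n"
  shows "alg_eval (mat_algebra n) (pCons a f) A = a \<cdot>\<^sub>m 1\<^sub>m n + A * alg_eval (mat_algebra n) f A"
proof -
  interpret B: ring "mat_algebra n :: ('a, 'a mat) module" by (rule ring_mat_algebra)
  have pow: "A ^\<^sub>m Suc i = A * A ^\<^sub>m i" for i
    using A by (induction i) (simp_all add: assoc_mult_mat[of _ n n _ n _ n])
  have fin: "A * (\<Oplus>\<^bsub>mat_algebra n\<^esub>i\<in>{..degree f}. Polynomial.coeff f i \<cdot>\<^sub>m A ^\<^sub>m i) =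
      (\<Oplus>\<^bsub>mat_algebra n\<^esub>i\<in>{..degree f}. A * (Polynomial.coeff f i \<cdot>\<^sub>m A ^\<^sub>m i))"
    using B.finsum_rdistr[of "{..degree f}" A "\<lambda>i. Polynomial.coeff f i \<cdot>\<^sub>m A ^\<^sub>m i"] A
    by (simp add: module_mat_simps Pi_def)
  have "alg_eval (mat_algebra n) (pCons a f) A =
      (\<Oplus>\<^bsub>mat_algebra n\<^esub>i\<in>{..Suc (degree f)}. Polynomial.coeff (pCons a f) i \<cdot>\<^sub>m A ^\<^sub>m i)"
    using A by (intro alg_eval_upto) (simp_all add: degree_pCons_le)
  also have "\<dots> = (\<Oplus>\<^bsub>mat_algebra n\<^esub>i\<in>{..degree f}. Polynomial.coeff f i \<cdot>\<^sub>m A ^\<^sub>m Suc i) + a \<cdot>\<^sub>m 1\<^sub>m n"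
    using A by (subst B.finsum_Suc2) (auto simp: module_mat_simps)
  also have "(\<Oplus>\<^bsub>mat_algebra n\<^esub>i\<in>{..degree f}. Polynomial.coeff f i \<cdot>\<^sub>m A ^\<^sub>m Suc i) =
      A * alg_eval (mat_algebra n) f A"
    unfolding alg_eval_upto[OF A order_refl] fin pow using A
    by (simp add: mult_smult_distrib[of _ n n _ n])
  also have "A * alg_eval (mat_algebra n) f A + a \<cdot>\<^sub>m 1\<^sub>m n = a \<cdot>\<^sub>m 1\<^sub>m n + A * alg_eval (mat_algebra n) f A"
    using A alg_eval_closed[OF A] by (intro comm_add_mat[of _ n n]) auto
  finally show ?thesis .
qed

lemma alg_eval_1:
  assumes "A \<in> carrier_mat n n"
  shows "alg_eval (mat_algebra n) 1 A = 1\<^sub>m n"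
  using assms alg_eval_pCons[OF assms, of 1 0]
  by (simp add: alg_eval_0 one_pCons one_smult_mat right_mult_zero_mat[of _ n n])

lemma alg_eval_add:
  assumes A: "A \<in> carrier_mat n n"
  shows "alg_eval (mat_algebra n) (f + g) A = alg_eval (mat_algebra n) f A + alg_eval (mat_algebra n) g A"
proof (induction f g rule: poly_induct2)
  case 0
  then show ?case by (simp add: alg_eval_0)
next
  case (pCons a f b g)
  let ?F = "alg_eval (mat_algebra n) f A" and ?G = "alg_eval (mat_algebra n) g A"
  interpret B: ring "mat_algebra n :: ('a, 'a mat) module" by (rule ring_mat_algebra)
  note [simp] = alg_eval_closed[OF A] A
  have "alg_eval (mat_algebra n) (pCons a f + pCons b g) A = (a + b) \<cdot>\<^sub>m 1\<^sub>m n + (A * ?F + A * ?G)"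
    by (simp add: alg_eval_pCons pCons mult_add_distrib_mat[of _ n n _ n])
  also have "\<dots> = (a \<cdot>\<^sub>m 1\<^sub>m n + A * ?F) + (b \<cdot>\<^sub>m 1\<^sub>m n + A * ?G)"
    using B.a_ac[unfolded module_mat_simps]
    by (simp add: add_smult_distrib_right_mat[of _ n n])
       (smt (verit) add_carrier_mat assoc_add_mat comm_add_mat mult_carrier_mat one_carrier_mat smult_carrier_mat A alg_eval_closed)
  finally show ?case by (simp add: alg_eval_pCons)
qed

lemma alg_eval_smult:
  assumes A: "A \<in> carrier_mat n n"
  shows "alg_eval (mat_algebra n) (Polynomial.smult c f) A = c \<cdot>\<^sub>m alg_eval (mat_algebra n) f A"
proof (induction f)
  case 0
  then show ?case by (simp add: alg_eval_0)
next
  case (pCons a f)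
  then show ?case using A alg_eval_closed[OF A, of f]
    by (simp add: alg_eval_pCons mult_smult_distrib[of _ n n _ n] add_smult_distrib_left_mat[of _ n n] smult_smult_mat)
qed

lemma alg_eval_mult:
  assumes A: "A \<in> carrier_mat n n"
  shows "alg_eval (mat_algebra n) (f * g) A = alg_eval (mat_algebra n) f A * alg_eval (mat_algebra n) g A"
proof (induction f)
  case 0
  then show ?case using alg_eval_closed[OF A, of g] by (simp add: alg_eval_0 left_mult_zero_mat)
next
  case (pCons a f)
  let ?F = "alg_eval (mat_algebra n) f A" and ?G = "alg_eval (mat_algebra n) g A"
  note c = A alg_eval_closed[OF A, of f] alg_eval_closed[OF A, of g]
  have "alg_eval (mat_algebra n) (pCons a f * g) A = a \<cdot>\<^sub>m ?G + A * (?F * ?G)"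
    using c by (simp add: alg_eval_add[OF A] alg_eval_smult[OF A] alg_eval_pCons[OF A] pCons.IH)
       (simp add: zero_smult_mat left_add_zero_mat[of _ n n])
  also have "\<dots> = (a \<cdot>\<^sub>m 1\<^sub>m n + A * ?F) * ?G"
    using c by (simp add: add_mult_distrib_mat[of _ n n _ _ n] mult_smult_assoc_mat[of _ n n _ n] assoc_mult_mat[of _ n n _ n _ n])
  finally show ?case by (simp add: alg_eval_pCons[OF A])
qed

lemma alg_eval_power:
  assumes A: "A \<in> carrier_mat n n"
  shows "alg_eval (mat_algebra n) (f ^ k) A = alg_eval (mat_algebra n) f A ^\<^sub>m k"
proof (induction k)
  case 0
  show ?case using alg_eval_closed[OF A, of f] by (simp add: alg_eval_1[OF A])
next
  case (Suc k)
  have "f ^ Suc k = f ^ k * f" by (simp add: mult.commute)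
  then show ?case by (simp only: alg_eval_mult[OF A] Suc pow_mat.simps)
qed

section \<open>Minimal polynomials as generators of annihilator ideals\<close>

text \<open>Replaces the description by least degree with the ideal-theoretic one: an annihilator of
  least degree is a constant multiple of the generator \<open>d\<close>, and monicity makes the
  constant 1.\<close>

lemma min_poly_mat_eqI:
  assumes "lead_coeff d = 1" and ann: "\<And>f. alg_eval (mat_algebra n) f A = 0\<^sub>m n n \<longleftrightarrow> d dvd f"
  shows "min_poly_mat n A = d"
  unfolding min_poly_mat_def
proof (rule the_equality)
  show "lead_coeff d = 1 \<and> alg_eval (mat_algebra n) d A = 0\<^sub>m n n \<and>
     (\<forall>f. f \<noteq> 0 \<and> alg_eval (mat_algebra n) f A = 0\<^sub>m n n \<longrightarrow> degree d \<le> degree f)"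
    using assms by (auto intro: dvd_imp_degree_le)
next
  fix m assume m: "lead_coeff m = 1 \<and> alg_eval (mat_algebra n) m A = 0\<^sub>m n n \<and>
     (\<forall>f. f \<noteq> 0 \<and> alg_eval (mat_algebra n) f A = 0\<^sub>m n n \<longrightarrow> degree m \<le> degree f)"
  have "d \<noteq> 0" "m \<noteq> 0" using assms(1) m by auto
  then have le: "degree m \<le> degree d" using m ann by auto
  have "d dvd m" using m ann by simp
  then obtain c where c: "m = d * c" by (rule dvdE)
  then have "c \<noteq> 0" using \<open>m \<noteq> 0\<close> by auto
  then have "degree c = 0" using le c \<open>d \<noteq> 0\<close> by (simp add: degree_mult_eq)
  then obtain a where "c = [:a:]" by (metis degree_0_id)
  then show "m = d" using c m assms(1) by (auto split: if_splits)
qed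

text \<open>Division with remainder by an annihilator of least degree leaves a remainder that also
  annihilates \<open>A\<close>, hence is zero. Rescaling makes the generator monic.\<close>

lemma annihilator_principal:
  fixes A :: "'k::field mat"
  assumes A: "A \<in> carrier_mat n n" and ex: "f\<^sub>0 \<noteq> 0" "alg_eval (mat_algebra n) f\<^sub>0 A = 0\<^sub>m n n"
  obtains d where "lead_coeff d = 1" "\<And>f. alg_eval (mat_algebra n) f A = 0\<^sub>m n n \<longleftrightarrow> d dvd f"
proof -
  define P where "P f \<longleftrightarrow> f \<noteq> 0 \<and> alg_eval (mat_algebra n) f A = 0\<^sub>m n n" for f
  have dvd: "P h" if "P g" "g dvd h" "h \<noteq> 0" for g h
    using that alg_eval_closed[OF A] by (auto simp: P_def alg_eval_mult[OF A] left_mult_zero_mat[of _ n n] elim!: dvdE)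
  have "P f\<^sub>0" using ex by (simp add: P_def)
  then obtain g where g: "P g" "\<And>f. P f \<Longrightarrow> degree g \<le> degree f"
    using ex_has_least_nat[of P "f\<^sub>0" degree] by auto
  have g_dvd: "g dvd f" if f: "alg_eval (mat_algebra n) f A = 0\<^sub>m n n" for f
  proof (rule ccontr)
    assume n: "\<not> g dvd f"
    \<comment> \<open>Only a sum and a product occur on the right, so the evaluation rules apply
      directly.\<close>
    have eq: "f mod g = f + g * (- (f div g))" by (simp add: minus_mult_div_eq_mod)
    have "alg_eval (mat_algebra n) (f mod g) A = 0\<^sub>m n n"
      unfolding eq alg_eval_add[OF A] alg_eval_mult[OF A]
      using f g(1) alg_eval_closed[OF A] by (simp add: P_def left_mult_zero_mat[of _ n n])
    moreover have nz: "f mod g \<noteq> 0" using n by (simp add: mod_eq_0_iff_dvd)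
    ultimately have "degree g \<le> degree (f mod g)" by (intro g) (simp add: P_def)
    then show False using degree_mod_less[of g f] g(1) nz by (auto simp: P_def)
  qed
  let ?d = "Polynomial.smult (inverse (lead_coeff g)) g"
  have "g \<noteq> 0" using g by (simp add: P_def)
  show thesis
  proof
    show "lead_coeff ?d = 1" using \<open>g \<noteq> 0\<close> by simp
    show "alg_eval (mat_algebra n) f A = 0\<^sub>m n n \<longleftrightarrow> ?d dvd f" for f
      using g_dvd[of f] dvd[OF g(1), of f] \<open>g \<noteq> 0\<close>
      by (cases "f = 0") (auto simp: smult_dvd_iff P_def alg_eval_0)
  qed
qed

section \<open>Jacobson radicals of quotients of the polynomial ring\<close>

lemma cring_poly_algebra: "cring (poly_algebra :: ('k::field, 'k poly) module)"
proof (rule cringI)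
  show "abelian_group (poly_algebra :: ('k, 'k poly) module)"
  proof (rule abelian_groupI)
    fix x :: "'k poly"
    show "\<exists>y\<in>carrier poly_algebra. y \<oplus>\<^bsub>poly_algebra\<^esub> x = \<zero>\<^bsub>poly_algebra\<^esub>"
      by (rule bexI[of _ "- x"]) (simp_all add: poly_algebra_def)
  qed (simp_all add: poly_algebra_def algebra_simps)
  show "comm_monoid (poly_algebra :: ('k, 'k poly) module)"
    by (rule comm_monoidI) (simp_all add: poly_algebra_def algebra_simps)
qed (simp_all add: poly_algebra_def algebra_simps)

text \<open>An abstract presentation of \<open>R\<close> as K[x]/(m), which turns questions about
  ideals of \<open>R\<close> into divisibility of polynomials. The intended case is K[A], with
  \<open>\<phi>\<close> the evaluation at \<open>A\<close>.\<close>

locale poly_algebra_image = cring R for R :: "('k::field, 'a, 'm) module_scheme" (structure) +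
  fixes \<phi> :: "'k poly \<Rightarrow> 'a" and m :: "'k poly"
  assumes hom_mult: "\<phi> (f * g) = \<phi> f \<otimes> \<phi> g"
    and hom_add: "\<phi> (f + g) = \<phi> f \<oplus> \<phi> g"
    and hom_one: "\<phi> 1 = \<one>"
    and hom_smult: "\<phi> (Polynomial.smult c f) = c \<odot>\<^bsub>R\<^esub> \<phi> f"
    and surj: "carrier R = range \<phi>"
    and kernel: "\<phi> f = \<zero> \<longleftrightarrow> m dvd f"
    and m_nonzero: "m \<noteq> 0"
begin

lemma hom_closed: "\<phi> f \<in> carrier R"
  using surj by simp

lemma hom_zero: "\<phi> 0 = \<zero>"
  using kernel by simp

lemma hom_uminus: "\<phi> (- f) = \<ominus> \<phi> f"
  by (rule minus_equality[symmetric]) (simp_all add: hom_closed hom_zero flip: hom_add)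

lemma hom_eq_iff: "\<phi> f = \<phi> g \<longleftrightarrow> m dvd f - g"
proof -
  have "\<phi> f = \<phi> g \<longleftrightarrow> \<phi> f \<oplus> \<ominus> \<phi> g = \<zero>"
    using hom_closed by (metis minus_equality minus_minus r_neg a_inv_closed)
  then show ?thesis by (simp add: kernel flip: hom_uminus hom_add)
qed

lemma hom_power: "\<phi> (f ^ k) = \<phi> f [^] k"
  by (induction k) (simp_all add: hom_one hom_mult hom_closed m_comm)

abbreviation J where "J \<equiv> \<phi> ` {f. squarefree_part m dvd f}"

lemma ideal_image_multiples: "ideal (\<phi> ` {f. q dvd f}) R"
proof (rule idealI[OF ring_axioms])
  show "subgroup (\<phi> ` {f. q dvd f}) (add_monoid R)"
  proof (rule add.subgroupI)
    show "\<phi> ` {f. q dvd f} \<subseteq> carrier R" using hom_closed by auto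
    show "\<phi> ` {f. q dvd f} \<noteq> {}" by auto
  next
    fix a assume "a \<in> \<phi> ` {f. q dvd f}"
    then show "\<ominus> a \<in> \<phi> ` {f. q dvd f}" by (auto simp flip: hom_uminus)
  next
    fix a b assume "a \<in> \<phi> ` {f. q dvd f}" "b \<in> \<phi> ` {f. q dvd f}"
    then show "a \<oplus> b \<in> \<phi> ` {f. q dvd f}" by (auto simp flip: hom_add)
  qed
next
  fix a x assume "a \<in> \<phi> ` {f. q dvd f}" "x \<in> carrier R"
  then show "x \<otimes> a \<in> \<phi> ` {f. q dvd f}" "a \<otimes> x \<in> \<phi> ` {f. q dvd f}"
    using surj by (auto simp flip: hom_mult)
qed

text \<open>The kernel consists of multiples of \<open>m\<close>, hence of \<open>q\<close>, so
  divisibility by \<open>q\<close> does not depend on the representative.\<close>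

lemma mem_image_multiples_iff:
  assumes "q dvd m"
  shows "\<phi> f \<in> \<phi> ` {f. q dvd f} \<longleftrightarrow> q dvd f"
proof
  assume "\<phi> f \<in> \<phi> ` {f. q dvd f}"
  then obtain g where "q dvd g" "m dvd f - g" using hom_eq_iff by auto
  then have "q dvd g + (f - g)" using assms by (intro dvd_add) (auto intro: dvd_trans)
  then show "q dvd f" by simp
qed auto

text \<open>The preimage of a larger ideal in K[x] is generated by an element of least degree. That
  generator divides \<open>q\<close> but is not divisible by \<open>q\<close>, so it is a
  unit.\<close>

lemma maximalideal_image_multiples:
  assumes q: "irreducible q" "q dvd m"
  shows "maximalideal (\<phi> ` {f. q dvd f}) R"
proof (rule maximalidealI[OF ideal_image_multiples])
  have "\<one> \<notin> \<phi> ` {f. q dvd f}"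
    using mem_image_multiples_iff[OF q(2), of 1] q(1) by (simp add: hom_one irreducible_def)
  then show "carrier R \<noteq> \<phi> ` {f. q dvd f}" by auto
next
  fix I assume I: "ideal I R" and sub: "\<phi> ` {f. q dvd f} \<subseteq> I" and carr: "I \<subseteq> carrier R"
  interpret I: ideal I R by (rule I)
  show "I = \<phi> ` {f. q dvd f} \<or> I = carrier R"
  proof (cases "I = carrier R")
    case False
    have "I = \<phi> ` {f. q dvd f}"
    proof (rule ccontr)
      assume "I \<noteq> \<phi> ` {f. q dvd f}"
      then have "\<not> I \<subseteq> \<phi> ` {f. q dvd f}" using sub by (simp add: subset_antisym)
      then obtain x where "x \<in> I" "x \<notin> \<phi> ` {f. q dvd f}" by blast
      moreover obtain f where "x = \<phi> f" using \<open>x \<in> I\<close> carr surj by blast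
      ultimately have f: "\<phi> f \<in> I" "\<not> q dvd f" by blast+
      define P where "P h \<longleftrightarrow> \<phi> h \<in> I \<and> h \<noteq> 0" for h
      have "\<phi> q \<in> I" by (intro subsetD[OF sub] imageI) simp
      then have "P q" using q(1) by (auto simp: P_def)
      then obtain h where h: "P h" "\<And>g. P g \<Longrightarrow> degree h \<le> degree g"
        using ex_has_least_nat[of P q degree] by auto
      have dvd: "h dvd g" if "\<phi> g \<in> I" for g
      proof (rule ccontr)
        assume n: "\<not> h dvd g"
        have "g mod h = g + - (h * (g div h))" by (simp add: minus_mult_div_eq_mod)
        then have "\<phi> (g mod h) = \<phi> g \<oplus> \<ominus> (\<phi> h \<otimes> \<phi> (g div h))"
          by (simp only: hom_add hom_uminus hom_mult)
        then have "\<phi> (g mod h) \<in> I"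
          using h that hom_closed by (simp add: P_def I.I_r_closed)
        moreover have "g mod h \<noteq> 0" using n by (simp add: mod_eq_0_iff_dvd)
        ultimately have "degree h \<le> degree (g mod h)" by (intro h) (simp add: P_def)
        then show False using degree_mod_less[of h g] h(1) \<open>g mod h \<noteq> 0\<close> by (auto simp: P_def)
      qed
      have "h dvd q" using \<open>P q\<close> dvd by (simp add: P_def)
      moreover have "\<not> q dvd h" using f dvd dvd_trans by blast
      ultimately have "is_unit h" using q(1) by (auto simp: irreducible_altdef)
      then obtain h' where "h * h' = 1" by (metis dvdE)
      then have "\<phi> h \<otimes> \<phi> h' = \<one>" by (metis hom_mult hom_one)
      then have "\<one> \<in> I" using h(1) hom_closed by (metis I.I_r_closed P_def)
      then show False using \<open>I \<noteq> carrier R\<close> I.one_imp_carrier by simp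
    qed
    then show ?thesis by simp
  qed simp
qed

text \<open>One inclusion tests only the maximal ideals coming from irreducible factors of
  \<open>m\<close>. The other uses that the squarefree part is nilpotent in \<open>R\<close>, which
  avoids classifying all maximal ideals.\<close>

lemma jacobson_radical_eq: "jacobson_radical R = J"
proof
  show "jacobson_radical R \<subseteq> J"
  proof
    fix x assume x: "x \<in> jacobson_radical R"
    then obtain f where f: "x = \<phi> f" using surj by (auto simp: jacobson_radical_def)
    have "q dvd f" if "irreducible q" "q dvd m" for q
      using x maximalideal_image_multiples[OF that] mem_image_multiples_iff[OF that(2), of f]
      by (auto simp: jacobson_radical_def f)
    then show "x \<in> J" using f squarefree_part_dvd_iff[OF m_nonzero] by auto
  qed
next
  obtain k where k: "m dvd squarefree_part m ^ k"
    using dvd_squarefree_part_power[OF m_nonzero] by blast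
  have "\<phi> (squarefree_part m) \<in> I" if "maximalideal I R" for I
  proof -
    interpret I: primeideal I R using that by (rule maximalideal_prime)
    have one: "\<one> \<notin> I" using I.one_imp_carrier I.I_notcarr by auto
    have "\<phi> (squarefree_part m) [^] k = \<zero>" using k by (simp add: kernel flip: hom_power)
    then have "\<phi> (squarefree_part m) [^] k \<in> I" by simp
    \<comment> \<open>Primeness strips off one factor of the power at a time; running down to
      exponent 0 would put \<open>\<one>\<close> into \<open>I\<close>.\<close>
    then show ?thesis
      using one by (induction k) (auto dest!: I.I_prime[rotated 2] simp: hom_closed)
  qed
  then show "J \<subseteq> jacobson_radical R"
    using hom_closed by (auto simp: jacobson_radical_def hom_mult elim!: dvdE
        intro!: ideal.I_r_closed maximalideal.axioms(1))
qed

text \<open>The preimage of \<open>J\<close> under \<open>\<phi>\<close> is the ideal generated by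
  the squarefree part. Taking preimages of cosets is thus an isomorphism with no choice of
  representatives, and taking images inverts it.\<close>

lemma alg_isomorphic_quotient:
  "alg_isomorphic (alg_quotient R (jacobson_radical R))
     (alg_quotient poly_algebra (PIdl\<^bsub>poly_algebra\<^esub> (squarefree_part m)))"
proof -
  let ?P = "poly_algebra :: ('k, 'k poly) module"
  let ?r = "squarefree_part m"
  let ?I = "PIdl\<^bsub>?P\<^esub> ?r"
  interpret P: cring ?P by (rule cring_poly_algebra)
  interpret J: ideal J R by (rule ideal_image_multiples)
  have "?I = {f. ?r dvd f}" by (auto simp: cgenideal_def poly_algebra_def mult.commute elim!: dvdE)
  then have mem_I: "f \<in> ?I \<longleftrightarrow> ?r dvd f" for f by simp
  interpret I: ideal ?I ?P by (rule P.cgenideal_ideal) (simp add: poly_algebra_def)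
  have mem_coset: "\<phi> g \<in> J +> \<phi> f \<longleftrightarrow> ?r dvd g - f" for f g
  proof -
    have "\<phi> g \<in> J +> \<phi> f \<longleftrightarrow> \<phi> (g - f) \<in> J"
      using J.a_rcos_module[OF hom_closed hom_closed, of g f] hom_add[of g "- f"]
      by (simp add: a_minus_def hom_uminus)
    then show ?thesis using mem_image_multiples_iff[OF squarefree_part_dvd[OF m_nonzero]] by simp
  qed
  have P_simps: "carrier ?P = UNIV" "f \<oplus>\<^bsub>?P\<^esub> g = f + g" "f \<otimes>\<^bsub>?P\<^esub> g = f * g" "\<one>\<^bsub>?P\<^esub> = 1"
    "c \<odot>\<^bsub>?P\<^esub> f = Polynomial.smult c f" for f g c
    by (simp_all add: poly_algebra_def)
  have mem_I_coset: "g \<in> ?I +>\<^bsub>?P\<^esub> f \<longleftrightarrow> ?r dvd g - f" for f g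
  proof -
    have "g \<in> ?I +>\<^bsub>?P\<^esub> f \<longleftrightarrow> (\<exists>h. ?r dvd h \<and> g = h + f)"
      by (auto simp: a_r_coset_def' mem_I P_simps)
    then show ?thesis by (metis add_diff_cancel diff_add_cancel)
  qed
  have vimage: "\<phi> -` (J +> \<phi> f) = ?I +>\<^bsub>?P\<^esub> f" for f
    using mem_coset mem_I_coset by auto
  have coset_eqI: "?I +>\<^bsub>?P\<^esub> g = ?I +>\<^bsub>?P\<^esub> f" if "?r dvd g - f" for f g
  proof -
    have "?r dvd h - g \<longleftrightarrow> ?r dvd h - f" for h
      using dvd_add_left_iff[OF that, of "h - g"] by simp
    then show ?thesis by (auto simp: mem_I_coset)
  qed
  have image: "\<phi> ` (?I +>\<^bsub>?P\<^esub> f) = J +> \<phi> f" for f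
  proof -
    have "J +> \<phi> f \<subseteq> range \<phi>"
      using a_r_coset_subset_G[OF J.a_subset hom_closed, of f] surj by simp
    then show ?thesis unfolding vimage[symmetric] by auto
  qed
  have vimage_image: "\<phi> -` \<phi> ` (?I +>\<^bsub>?P\<^esub> f) = ?I +>\<^bsub>?P\<^esub> f" for f
    by (simp only: image vimage)
  \<comment> \<open>All members of the union are the same coset, and the union is not empty, so it
    collapses to that coset.\<close>
  have smult: "(\<Union>x\<in>J +> \<phi> f. J +> (c \<odot>\<^bsub>R\<^esub> x)) = J +> \<phi> (Polynomial.smult c f)" for c f
  proof -
    have "J +> (c \<odot>\<^bsub>R\<^esub> x) = J +> \<phi> (Polynomial.smult c f)" if "x \<in> J +> \<phi> f" for x
    proof -
      obtain g where g: "x = \<phi> g" "?r dvd g - f" using \<open>x \<in> J +> \<phi> f\<close> mem_I_coset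
        unfolding image[symmetric] by auto
      then have "?r dvd Polynomial.smult c g - Polynomial.smult c f"
        by (simp add: dvd_smult flip: smult_diff_right)
      then show ?thesis using coset_eqI g(1) by (metis hom_smult image)
    qed
    moreover have "J +> \<phi> f \<noteq> {}" using J.a_rcos_self[OF hom_closed] by auto
    ultimately show ?thesis by auto
  qed
  have smult_I: "(\<Union>x\<in>?I +>\<^bsub>?P\<^esub> f. ?I +>\<^bsub>?P\<^esub> (c \<odot>\<^bsub>?P\<^esub> x)) = ?I +>\<^bsub>?P\<^esub> (Polynomial.smult c f)" for c f
  proof -
    have "?I +>\<^bsub>?P\<^esub> (c \<odot>\<^bsub>?P\<^esub> g) = ?I +>\<^bsub>?P\<^esub> (Polynomial.smult c f)" if "g \<in> ?I +>\<^bsub>?P\<^esub> f" for g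
      using that by (intro coset_eqI) (simp add: mem_I_coset P_simps dvd_smult flip: smult_diff_right)
    moreover have "f \<in> ?I +>\<^bsub>?P\<^esub> f" by (simp add: mem_I_coset)
    ultimately show ?thesis by auto
  qed
  have carr: "carrier (R Quot J) = range (\<lambda>f. J +> \<phi> f)"
    "carrier (?P Quot ?I) = range (\<lambda>f. ?I +>\<^bsub>?P\<^esub> f)"
    by (auto simp: FactRing_def A_RCOSETS_def' surj P_simps)
  have "(\<lambda>X. \<phi> -` X) \<in> ring_iso (R Quot J) (?P Quot ?I)"
    unfolding ring_iso_def
  proof (intro CollectI conjI ring_hom_memI)
    fix X Y assume "X \<in> carrier (R Quot J)" "Y \<in> carrier (R Quot J)"
    then obtain f g where fg: "X = J +> \<phi> f" "Y = J +> \<phi> g" by (auto simp: carr)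
    have P: "h \<in> carrier ?P" for h by (simp add: P_simps)
    have "X \<otimes>\<^bsub>R Quot J\<^esub> Y = J +> \<phi> (f * g)"
      by (simp add: fg FactRing_def J.rcoset_mult_add hom_closed hom_mult)
    then show "\<phi> -` (X \<otimes>\<^bsub>R Quot J\<^esub> Y) = \<phi> -` X \<otimes>\<^bsub>?P Quot ?I\<^esub> \<phi> -` Y"
      using I.rcoset_mult_add[OF P P, of f g] by (simp only: fg vimage) (simp add: FactRing_def P_simps)
    have "X \<oplus>\<^bsub>R Quot J\<^esub> Y = J +> \<phi> (f + g)"
      by (simp add: fg FactRing_def J.a_rcos_sum hom_closed hom_add)
    then show "\<phi> -` (X \<oplus>\<^bsub>R Quot J\<^esub> Y) = \<phi> -` X \<oplus>\<^bsub>?P Quot ?I\<^esub> \<phi> -` Y"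
      using I.a_rcos_sum[OF P P, of f g] by (simp only: fg vimage) (simp add: FactRing_def P_simps)
  next
    show "\<phi> -` \<one>\<^bsub>R Quot J\<^esub> = \<one>\<^bsub>?P Quot ?I\<^esub>"
      using vimage[of 1] by (simp add: FactRing_def hom_one P_simps)
    show "bij_betw (\<lambda>X. \<phi> -` X) (carrier (R Quot J)) (carrier (?P Quot ?I))"
      by (rule bij_betw_byWitness[where f' = "\<lambda>X. \<phi> ` X"]) (simp_all add: carr image_subset_iff vimage image vimage_image del: image_vimage_eq)
  qed (auto simp: carr vimage)
  moreover have "\<phi> -` (\<Union>x\<in>X. J +> (c \<odot>\<^bsub>R\<^esub> x)) = (\<Union>x\<in>\<phi> -` X. ?I +>\<^bsub>?P\<^esub> (c \<odot>\<^bsub>?P\<^esub> x))"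
    if "X \<in> carrier (R Quot J)" for X c
  proof -
    obtain f where "X = J +> \<phi> f" using \<open>X \<in> carrier (R Quot J)\<close> by (auto simp: carr)
    then show ?thesis by (simp only: smult vimage smult_I)
  qed
  ultimately show ?thesis
    unfolding jacobson_radical_eq alg_isomorphic_def alg_quotient_def ring.defs
    by (intro bexI[of _ "\<lambda>X. \<phi> -` X"]) (auto simp: ring_iso_def Ring.ring_hom_def)
qed

end

section \<open>Convolution matrices\<close>

lemma smult_pow_mat:
  fixes X :: "'k::comm_semiring_1 mat"
  assumes "X \<in> carrier_mat n n"
  shows "(c \<cdot>\<^sub>m X) ^\<^sub>m k = c ^ k \<cdot>\<^sub>m X ^\<^sub>m k"
proof (induction k)
  case 0
  then show ?case using assms by (simp add: one_smult_mat)
next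
  case (Suc k)
  then show ?case using assms
    by (simp add: mult_smult_distrib[of _ n n _ n] mult_smult_assoc_mat[of _ n n _ n] smult_smult_mat mult.commute)
qed

locale enumerated_comm_group = comm_group G for G :: "('g, 'm) monoid_scheme" (structure) +
  fixes n :: nat and e :: "nat \<Rightarrow> 'g"
  assumes enum: "bij_betw e {..<n} (carrier G)"
begin

lemma finite_carrier: "finite (carrier G)"
  using bij_betw_finite[OF enum] by simp

lemma enum_closed: "i < n \<Longrightarrow> e i \<in> carrier G"
  using enum by (auto dest: bij_betw_apply)

lemma enum_obtain:
  assumes "x \<in> carrier G"
  obtains i where "i < n" "e i = x"
  using assms enum unfolding bij_betw_def by (metis imageE lessThan_iff)

lemma enum_inj: "i < n \<Longrightarrow> j < n \<Longrightarrow> e i = e j \<longleftrightarrow> i = j"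
  using enum by (auto simp: bij_betw_def dest: inj_onD)

abbreviation W :: "('g \<Rightarrow> 'k) \<Rightarrow> 'k mat" where "W \<equiv> weighted_cayley_mat G n e"

text \<open>The product of the group algebra K[G], whose elements are represented by their
  coefficient functions.\<close>

definition conv :: "('g \<Rightarrow> 'k::semiring_0) \<Rightarrow> ('g \<Rightarrow> 'k) \<Rightarrow> 'g \<Rightarrow> 'k" where
  "conv u v x = (\<Sum>t\<in>carrier G. u t * v (x \<otimes> inv t))"

lemma W_closed [simp]: "W u \<in> carrier_mat n n"
  by (simp add: weighted_cayley_mat_def)

lemma W_index: "i < n \<Longrightarrow> j < n \<Longrightarrow> W u $$ (i, j) = u (e j \<otimes> inv e i)"
  by (simp add: weighted_cayley_mat_def)

text \<open>The row belonging to the identity of the group lists all values of \<open>u\<close> on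
  the carrier, so the matrix determines them.\<close>

lemma W_eq_iff: "W u = W v \<longleftrightarrow> (\<forall>x\<in>carrier G. u x = v x)"
proof
  assume eq: "W u = W v"
  show "\<forall>x\<in>carrier G. u x = v x"
  proof
    fix x assume x: "x \<in> carrier G"
    obtain i j where "i < n" "e i = \<one>" "j < n" "e j = x" using x enum_obtain one_closed by metis
    then show "u x = v x" using eq x W_index[of i j u] W_index[of i j v] by simp
  qed
next
  assume "\<forall>x\<in>carrier G. u x = v x"
  then show "W u = W v"
    by (intro eq_matI) (auto simp: W_index enum_closed weighted_cayley_mat_def)
qed

lemma W_zero: "W (\<lambda>_. 0) = 0\<^sub>m n n"
  by (rule eq_matI) (auto simp: weighted_cayley_mat_def)

lemma W_one: "W (\<lambda>x. if x = \<one> then 1 else 0) = (1\<^sub>m n :: 'k::{zero,one} mat)"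
proof (rule eq_matI)
  fix i j assume ij: "i < dim_row (1\<^sub>m n :: 'k mat)" "j < dim_col (1\<^sub>m n :: 'k mat)"
  have "e j \<otimes> inv e i = \<one> \<longleftrightarrow> i = j"
    using ij enum_closed enum_inj[of j i]
    by (auto simp: inv_solve_right' simp flip: inv_solve_right)
  then show "W (\<lambda>x. if x = \<one> then 1 else 0) $$ (i, j) = (1\<^sub>m n :: 'k mat) $$ (i, j)"
    using ij by (simp add: W_index)
qed (auto simp: weighted_cayley_mat_def)

lemma W_add: "W u + W v = W (\<lambda>x. u x + v x)"
  by (rule eq_matI) (auto simp: weighted_cayley_mat_def)

lemma W_smult: "c \<cdot>\<^sub>m W u = W (\<lambda>x. c * u x)"
  by (rule eq_matI) (auto simp: weighted_cayley_mat_def)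

text \<open>The substitution \<open>t = e k \<otimes> inv e i\<close>, a right translation of the
  group, turns the sum over the inner matrix index into a convolution. Matrices of the form
  \<open>W u\<close> thus represent K[G].\<close>

lemma W_mult: "W u * W v = W (conv u v)"
proof (rule eq_matI)
  fix i j assume "i < dim_row (W (conv u v))" "j < dim_col (W (conv u v))"
  then have i: "i < n" and j: "j < n" by (simp_all add: weighted_cayley_mat_def)
  note carr = enum_closed[OF i] enum_closed[OF j]
  have bij: "bij_betw (\<lambda>k. e k \<otimes> inv e i) {..<n} (carrier G)"
  proof -
    have "bij_betw (\<lambda>x. x \<otimes> inv e i) (carrier G) (carrier G)"
      by (rule bij_betw_byWitness[where f' = "\<lambda>x. x \<otimes> e i"]) (use carr in \<open>auto simp: m_assoc\<close>)
    then show ?thesis using bij_betw_trans[OF enum] by (simp add: o_def)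
  qed
  have "(W u * W v) $$ (i, j) = (\<Sum>k<n. u (e k \<otimes> inv e i) * v (e j \<otimes> inv e k))"
    using i j by (simp add: weighted_cayley_mat_def scalar_prod_def lessThan_atLeast0)
  also have "\<dots> = (\<Sum>k<n. u (e k \<otimes> inv e i) * v (e j \<otimes> inv e i \<otimes> inv (e k \<otimes> inv e i)))"
  proof (rule sum.cong)
    fix k assume "k \<in> {..<n}"
    then have k: "e k \<in> carrier G" by (simp add: enum_closed)
    have "e j \<otimes> inv e i \<otimes> inv (e k \<otimes> inv e i) = e j \<otimes> inv e k"
      using carr k by (simp add: inv_mult_group m_assoc) (simp add: m_assoc[symmetric])
    then show "u (e k \<otimes> inv e i) * v (e j \<otimes> inv e k) =
        u (e k \<otimes> inv e i) * v (e j \<otimes> inv e i \<otimes> inv (e k \<otimes> inv e i))" by simp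
  qed simp
  also have "\<dots> = conv u v (e j \<otimes> inv e i)"
    unfolding conv_def by (rule sum.reindex_bij_betw[OF bij])
  finally show "(W u * W v) $$ (i, j) = W (conv u v) $$ (i, j)" using i j by (simp add: W_index)
qed (auto simp: weighted_cayley_mat_def)

text \<open>The group elements, viewed as the standard basis of K[G].\<close>

definition delta :: "'g \<Rightarrow> 'g \<Rightarrow> 'k::zero_neq_one" where
  "delta g x = (if x = g then 1 else 0)"

lemma conv_delta:
  assumes "g \<in> carrier G" "h \<in> carrier G" "x \<in> carrier G"
  shows "conv (delta g) (delta h) x = (delta (g \<otimes> h) x :: 'k::semiring_1)"
proof -
  have "conv (delta g) (delta h) x = (\<Sum>t\<in>carrier G. if t = g then delta h (x \<otimes> inv t) else 0 :: 'k)"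
    unfolding conv_def by (rule sum.cong) (simp_all add: delta_def)
  also have "\<dots> = delta h (x \<otimes> inv g)" using assms by (simp add: finite_carrier)
  also have "x \<otimes> inv g = h \<longleftrightarrow> x = g \<otimes> h"
    using assms by (metis inv_solve_right m_comm)
  then have "delta h (x \<otimes> inv g) = (delta (g \<otimes> h) x :: 'k)" by (simp add: delta_def)
  finally show ?thesis .
qed

lemma W_delta_mult:
  "g \<in> carrier G \<Longrightarrow> h \<in> carrier G \<Longrightarrow> W (delta g) * W (delta h) = (W (delta (g \<otimes> h)) :: 'k::semiring_1 mat)"
  by (simp add: W_mult W_eq_iff conv_delta)

lemma W_delta_power:
  "g \<in> carrier G \<Longrightarrow> W (delta g) ^\<^sub>m k = (W (delta (g [^] k)) :: 'k::semiring_1 mat)"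
proof (induction k)
  case 0
  have "W (delta \<one>) = (1\<^sub>m n :: 'k mat)" using W_one by (simp add: delta_def[abs_def])
  then show ?case by (simp add: weighted_cayley_mat_def)
qed (simp add: W_delta_mult)

lemma W_finsum:
  assumes "finite I"
  shows "(\<Oplus>\<^bsub>mat_algebra n\<^esub>i\<in>I. W (f i)) = W (\<lambda>x. \<Sum>i\<in>I. f i x :: 'k::field)"
proof -
  interpret B: ring "mat_algebra n :: ('k, 'k mat) module" by (rule ring_mat_algebra)
  show ?thesis
    using assms
  proof (induction I)
    case empty
    then show ?case by (simp add: module_mat_simps W_zero)
  next
    case (insert i I)
    then show ?case by (subst B.finsum_insert) (auto simp: module_mat_simps W_add)
  qed
qed

text \<open>Expand \<open>u\<close> in the basis \<open>delta g\<close>; the terms commute, so the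
  power passes through the sum. After collecting the terms with equal \<open>g [^] q\<close>, the
  Frobenius map of the field pulls the power out of each fibre sum.\<close>

lemma W_frobenius:
  fixes u :: "'g \<Rightarrow> 'k::field"
  assumes p: "Factorial_Ring.prime (CHAR('k))" and q: "q = CHAR('k) ^ j"
  shows "W u ^\<^sub>m q = W (\<lambda>x. (\<Sum>g | g \<in> carrier G \<and> g [^] q = x. u g) ^ q)"
proof -
  interpret B: ring "mat_algebra n :: ('k, 'k mat) module" by (rule ring_mat_algebra)
  let ?p = "CHAR('k)"
  let ?F = "\<lambda>g. u g \<cdot>\<^sub>m W (delta g)"
  have "[k] \<cdot>\<^bsub>mat_algebra n\<^esub> \<one>\<^bsub>mat_algebra n\<^esub> = (of_nat k :: 'k) \<cdot>\<^sub>m 1\<^sub>m n" for k :: nat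
    by (induction k) (auto simp: module_mat_simps zero_smult_mat add_smult_distrib_right_mat[of _ n n] one_smult_mat algebra_simps)
  then have char: "[?p] \<cdot>\<^bsub>mat_algebra n\<^esub> \<one>\<^bsub>mat_algebra n\<^esub> = \<zero>\<^bsub>mat_algebra n :: ('k, 'k mat) module\<^esub>"
    by (simp add: zero_smult_mat module_mat_simps)
  have carr: "?F g \<in> carrier_mat n n" for g by simp
  have comm: "?F g * ?F h = ?F h * ?F g" if "g \<in> carrier G" "h \<in> carrier G" for g h
    using that by (simp add: mult_smult_distrib[of _ n n _ n] mult_smult_assoc_mat[of _ n n _ n]
        smult_smult_mat W_delta_mult m_comm mult.commute)
  have "(\<Oplus>\<^bsub>mat_algebra n\<^esub>g\<in>carrier G. ?F g) = W (\<lambda>x. \<Sum>g\<in>carrier G. u g * delta g x)"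
    by (simp add: W_smult W_finsum finite_carrier)
  also have "\<dots> = W u"
    unfolding W_eq_iff by (simp add: delta_def finite_carrier if_distrib cong: if_cong)
  finally have "W u ^\<^sub>m q = (\<Oplus>\<^bsub>mat_algebra n\<^esub>g\<in>carrier G. ?F g) [^]\<^bsub>mat_algebra n\<^esub> q"
    by (simp add: mat_algebra_nat_pow)
  also have "\<dots> = (\<Oplus>\<^bsub>mat_algebra n\<^esub>g\<in>carrier G. ?F g [^]\<^bsub>mat_algebra n\<^esub> q)"
    unfolding q by (rule B.frobenius_power_finsum[OF p char finite_carrier])
      (auto simp: module_mat_simps comm)
  also have "\<dots> = (\<Oplus>\<^bsub>mat_algebra n\<^esub>g\<in>carrier G. W (\<lambda>x. u g ^ q * delta (g [^] q) x))"
  proof (rule B.finsum_cong')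
    fix g assume "g \<in> carrier G"
    then show "?F g [^]\<^bsub>mat_algebra n\<^esub> q = W (\<lambda>x. u g ^ q * delta (g [^] q) x)"
      by (simp only: mat_algebra_nat_pow[OF carr] smult_pow_mat[OF W_closed] W_delta_power)
        (simp only: W_smult)
  qed (auto simp: module_mat_simps)
  also have "\<dots> = W (\<lambda>x. \<Sum>g\<in>carrier G. u g ^ q * delta (g [^] q) x)"
    by (rule W_finsum[OF finite_carrier])
  also have "\<dots> = W (\<lambda>x. (\<Sum>g | g \<in> carrier G \<and> g [^] q = x. u g) ^ q)"
  proof -
    have "(\<Sum>g\<in>carrier G. u g ^ q * delta (g [^] q) x) = (\<Sum>g | g \<in> carrier G \<and> g [^] q = x. u g) ^ q" for x
    proof -
      have "(\<Sum>g\<in>carrier G. u g ^ q * delta (g [^] q) x) = (\<Sum>g\<in>carrier G. if g [^] q = x then u g ^ q else 0)"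
        by (rule sum.cong) (auto simp: delta_def)
      also have "\<dots> = (\<Sum>g | g \<in> carrier G \<and> g [^] q = x. u g ^ q)"
        by (simp add: sum.inter_filter finite_carrier)
      finally show ?thesis unfolding q by (simp only: freshmans_dream_sum'[OF p refl])
    qed
    then show ?thesis by simp
  qed
  finally show ?thesis .
qed

end

section \<open>Transport of group algebra elements along a surjective homomorphism\<close>

locale enumerated_group_epi =
  G: enumerated_comm_group G n e + H: enumerated_comm_group H l e' + group_hom G H \<pi>
  for G :: "('g, 'm) monoid_scheme" and n e and H :: "('h, 'r) monoid_scheme" and l e' and \<pi> +
  assumes surj: "\<pi> ` carrier G = carrier H"
begin

text \<open>The linear extension of \<open>\<pi>\<close> to a map from K[G] to K[H], written in
  terms of coefficient functions.\<close>

definition push :: "('g \<Rightarrow> 'k::comm_monoid_add) \<Rightarrow> 'h \<Rightarrow> 'k" where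
  "push u y = (\<Sum>g | g \<in> carrier G \<and> \<pi> g = y. u g)"

lemma push_add: "push (\<lambda>x. u x + v x) y = push u y + push v y"
  by (simp add: push_def sum.distrib)

lemma push_smult: "push (\<lambda>x. c * u x :: 'k::semiring_0) y = c * push u y"
  by (simp add: push_def sum_distrib_left)

lemma push_one:
  "push (\<lambda>x. if x = \<one>\<^bsub>G\<^esub> then 1 else 0) y = (if y = \<one>\<^bsub>H\<^esub> then 1 else 0 :: 'k::semiring_1)"
proof -
  have "push (\<lambda>x. if x = \<one>\<^bsub>G\<^esub> then 1 else 0) y =
      (\<Sum>g\<in>{g \<in> carrier G. \<pi> g = y} \<inter> {\<one>\<^bsub>G\<^esub>}. 1 :: 'k)"
    unfolding push_def by (rule sum.mono_neutral_cong_right) (auto simp: G.finite_carrier)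
  also have "{g \<in> carrier G. \<pi> g = y} \<inter> {\<one>\<^bsub>G\<^esub>} = (if y = \<one>\<^bsub>H\<^esub> then {\<one>\<^bsub>G\<^esub>} else {})"
    by auto
  finally show ?thesis by (simp split: if_splits)
qed

text \<open>Multiplication by the inverse of \<open>t\<close> carries the fibre over
  \<open>y\<close> bijectively onto the fibre over \<open>y\<close> times the inverse of
  \<open>\<pi> t\<close>. Grouping the remaining sum over \<open>t\<close> by \<open>\<pi> t\<close>
  gives the convolution on \<open>H\<close>.\<close>

lemma push_conv:
  fixes u v :: "'g \<Rightarrow> 'k::semiring_0"
  assumes y: "y \<in> carrier H"
  shows "push (G.conv u v) y = H.conv (push u) (push v) y"
proof -
  have shift: "(\<Sum>g | g \<in> carrier G \<and> \<pi> g = y. v (g \<otimes>\<^bsub>G\<^esub> inv\<^bsub>G\<^esub> t)) = push v (y \<otimes>\<^bsub>H\<^esub> inv\<^bsub>H\<^esub> \<pi> t)"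
    if t: "t \<in> carrier G" for t
    unfolding push_def
  proof (rule sum.reindex_bij_witness[where i = "\<lambda>g. g \<otimes>\<^bsub>G\<^esub> t" and j = "\<lambda>g. g \<otimes>\<^bsub>G\<^esub> inv\<^bsub>G\<^esub> t"])
    fix g assume "g \<in> {g \<in> carrier G. \<pi> g = y \<otimes>\<^bsub>H\<^esub> inv\<^bsub>H\<^esub> \<pi> t}"
    then show "g \<otimes>\<^bsub>G\<^esub> t \<in> {g \<in> carrier G. \<pi> g = y}"
      using t y by (auto simp: H.m_assoc)
  qed (use t in \<open>auto simp: G.m_assoc\<close>)
  have "push (G.conv u v) y = (\<Sum>t\<in>carrier G. u t * push v (y \<otimes>\<^bsub>H\<^esub> inv\<^bsub>H\<^esub> \<pi> t))"
    unfolding push_def[of "G.conv u v"] G.conv_def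
    by (subst sum.swap) (simp add: shift flip: sum_distrib_left)
  also have "\<dots> = (\<Sum>z\<in>carrier H. \<Sum>t | t \<in> carrier G \<and> \<pi> t = z. u t * push v (y \<otimes>\<^bsub>H\<^esub> inv\<^bsub>H\<^esub> \<pi> t))"
    by (rule sum.group[symmetric]) (auto simp: G.finite_carrier H.finite_carrier)
  also have "\<dots> = H.conv (push u) (push v) y"
    unfolding H.conv_def push_def[of u] by (simp add: sum_distrib_right)
  finally show ?thesis .
qed

text \<open>The witness \<open>v\<close> is the value of \<open>f\<close> at \<open>u\<close> in
  K[G]; since \<open>push\<close> is an algebra homomorphism, its image is the value of
  \<open>f\<close> at \<open>push u\<close>.\<close>

lemma alg_eval_push:
  fixes f :: "'k::field poly"
  shows "\<exists>v. alg_eval (mat_algebra n) f (G.W u) = G.W v \<and> alg_eval (mat_algebra l) f (H.W (push u)) = H.W (push v)"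
proof (induction f)
  case 0
  have "push (\<lambda>_. 0 :: 'k) = (\<lambda>_. 0)" by (auto simp: push_def)
  then show ?case by (intro exI[of _ "\<lambda>_. 0"]) (simp add: alg_eval_0 G.W_zero H.W_zero)
next
  case (pCons a f)
  then obtain v where v: "alg_eval (mat_algebra n) f (G.W u) = G.W v"
    "alg_eval (mat_algebra l) f (H.W (push u)) = H.W (push v)" by blast
  \<comment> \<open>The Horner step \<open>a + u * v\<close> computed in the group algebra.\<close>
  let ?w = "\<lambda>x. a * (if x = \<one>\<^bsub>G\<^esub> then 1 else 0) + G.conv u v x"
  have "alg_eval (mat_algebra n) (pCons a f) (G.W u) = G.W ?w"
    by (simp only: alg_eval_pCons[OF G.W_closed] v G.W_mult G.W_smult G.W_add flip: G.W_one)
  moreover have "alg_eval (mat_algebra l) (pCons a f) (H.W (push u)) = H.W (push ?w)"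
  proof -
    have "alg_eval (mat_algebra l) (pCons a f) (H.W (push u)) =
        H.W (\<lambda>y. a * (if y = \<one>\<^bsub>H\<^esub> then 1 else 0) + H.conv (push u) (push v) y)"
      by (simp only: alg_eval_pCons[OF H.W_closed] v H.W_mult H.W_smult H.W_add flip: H.W_one)
    also have "\<dots> = H.W (push ?w)"
      by (subst H.W_eq_iff) (simp add: push_add push_smult push_one push_conv)
    finally show ?thesis .
  qed
  ultimately show ?case by blast
qed

text \<open>When the \<open>q\<close>-th power map and \<open>\<pi>\<close> have the same fibres,
  the coefficients of the power at elements \<open>h [^] q\<close> are the \<open>q\<close>-th
  powers of the values of \<open>push u\<close>. A field has no nilpotents, so both sides vanish
  together.\<close>

lemma W_power_eq_0_iff:
  fixes u :: "'g \<Rightarrow> 'k::field"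
  assumes p: "Factorial_Ring.prime (CHAR('k))" and q: "q = CHAR('k) ^ j"
    and fibres: "\<And>g h. g \<in> carrier G \<Longrightarrow> h \<in> carrier G \<Longrightarrow> g [^]\<^bsub>G\<^esub> q = h [^]\<^bsub>G\<^esub> q \<longleftrightarrow> \<pi> g = \<pi> h"
  shows "G.W u ^\<^sub>m q = 0\<^sub>m n n \<longleftrightarrow> H.W (push u) = 0\<^sub>m l l"
proof -
  have "q > 0" using p q prime_gt_0_nat by simp
  have fibre: "{g \<in> carrier G. g [^]\<^bsub>G\<^esub> q = h [^]\<^bsub>G\<^esub> q} = {g \<in> carrier G. \<pi> g = \<pi> h}"
    if "h \<in> carrier G" for h
    using fibres that by auto
  have "G.W u ^\<^sub>m q = 0\<^sub>m n n \<longleftrightarrow>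
      (\<forall>x\<in>carrier G. (\<Sum>g | g \<in> carrier G \<and> g [^]\<^bsub>G\<^esub> q = x. u g) = 0)"
    using \<open>q > 0\<close> by (simp add: G.W_frobenius[OF p q] G.W_eq_iff flip: G.W_zero)
  also have "\<dots> \<longleftrightarrow> (\<forall>h\<in>carrier G. (\<Sum>g | g \<in> carrier G \<and> g [^]\<^bsub>G\<^esub> q = h [^]\<^bsub>G\<^esub> q. u g) = 0)"
  proof (intro iffI ballI)
    fix x assume "x \<in> carrier G"
      and *: "\<forall>h\<in>carrier G. (\<Sum>g | g \<in> carrier G \<and> g [^]\<^bsub>G\<^esub> q = h [^]\<^bsub>G\<^esub> q. u g) = 0"
    show "(\<Sum>g | g \<in> carrier G \<and> g [^]\<^bsub>G\<^esub> q = x. u g) = 0"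
    proof (cases "\<exists>h\<in>carrier G. x = h [^]\<^bsub>G\<^esub> q")
      case False
      \<comment> \<open>An element that is not a \<open>q\<close>-th power has an empty
        fibre.\<close>
      then show ?thesis by (intro sum.neutral) auto
    qed (use * in auto)
  qed simp
  also have "\<dots> \<longleftrightarrow> (\<forall>h\<in>carrier G. push u (\<pi> h) = 0)"
    by (simp add: fibre push_def)
  also have "\<dots> \<longleftrightarrow> (\<forall>y\<in>carrier H. push u y = 0)"
    unfolding surj[symmetric] by simp
  also have "\<dots> \<longleftrightarrow> H.W (push u) = 0\<^sub>m l l"
    by (simp add: H.W_eq_iff flip: H.W_zero)
  finally show ?thesis .
qed

text \<open>The exponent \<open>a\<close> suffices to deduce divisibility from vanishing. The
  converse may need a larger exponent to exceed the multiplicities in \<open>m\<close>, which is why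
  the fibre condition is assumed for all \<open>j \<ge> a\<close>.\<close>

lemma min_poly_push:
  fixes u :: "'g \<Rightarrow> 'k::field"
  assumes p: "Factorial_Ring.prime (CHAR('k))"
    and fibres: "\<And>j g h. j \<ge> a \<Longrightarrow> g \<in> carrier G \<Longrightarrow> h \<in> carrier G \<Longrightarrow>
        g [^]\<^bsub>G\<^esub> (CHAR('k) ^ j) = h [^]\<^bsub>G\<^esub> (CHAR('k) ^ j) \<longleftrightarrow> \<pi> g = \<pi> h"
    and m: "m \<noteq> 0" "\<And>f. alg_eval (mat_algebra n) f (G.W u) = 0\<^sub>m n n \<longleftrightarrow> m dvd f"
  shows "min_poly_mat l (H.W (push u)) = squarefree_part m"
proof (rule min_poly_mat_eqI[OF lead_coeff_squarefree_part])
  have nilpotent: "alg_eval (mat_algebra l) f (H.W (push u)) = 0\<^sub>m l l \<longleftrightarrow> m dvd f ^ (CHAR('k) ^ j)"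
    if "j \<ge> a" for f j
  proof -
    obtain v where v: "alg_eval (mat_algebra n) f (G.W u) = G.W v"
      "alg_eval (mat_algebra l) f (H.W (push u)) = H.W (push v)" using alg_eval_push by blast
    show ?thesis
      using W_power_eq_0_iff[OF p refl fibres[OF that], of v] v(1)
      by (simp add: v(2) m(2)[symmetric] alg_eval_power[OF G.W_closed])
  qed
  show "alg_eval (mat_algebra l) f (H.W (push u)) = 0\<^sub>m l l \<longleftrightarrow> squarefree_part m dvd f" for f
  proof
    assume "alg_eval (mat_algebra l) f (H.W (push u)) = 0\<^sub>m l l"
    then have dvd: "m dvd f ^ (CHAR('k) ^ a)" using nilpotent[of a f] by simp
    have "q dvd f" if "irreducible q" "q dvd m" for q
    proof -
      have "q dvd f ^ (CHAR('k) ^ a)" using that(2) dvd by (rule dvd_trans)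
      then show ?thesis using field_poly_irreducible_imp_prime[OF that(1)]
        by (simp add: prime_elem_dvd_power)
    qed
    then show "squarefree_part m dvd f" using squarefree_part_dvd_iff[OF m(1)] by blast
  next
    assume dvd: "squarefree_part m dvd f"
    obtain k where k: "m dvd squarefree_part m ^ k" using dvd_squarefree_part_power[OF m(1)] by blast
    \<comment> \<open>At least \<open>a\<close>, so that \<open>nilpotent\<close> applies, and at
      least \<open>k\<close>, so that the power of the characteristic exceeds
      \<open>k\<close>.\<close>
    let ?j = "max a k"
    have "k \<le> CHAR('k) ^ ?j"
    proof -
      have "k < CHAR('k) ^ k" using prime_gt_1_nat[OF p] by (intro power_gt_expt) simp
      also have "\<dots> \<le> CHAR('k) ^ ?j" using prime_ge_1_nat[OF p] by (intro power_increasing) auto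
      finally show ?thesis by simp
    qed
    then have "squarefree_part m ^ k dvd f ^ (CHAR('k) ^ ?j)"
      using dvd by (meson dvd_power_le)
    then show "alg_eval (mat_algebra l) f (H.W (push u)) = 0\<^sub>m l l"
      using nilpotent[of ?j f] k dvd_trans by auto
  qed
qed

end

section \<open>Cayley graphs\<close>

text \<open>The carrier is the image of K[x] under evaluation, hence a ring, and it inherits
  commutativity from polynomial multiplication although the ambient matrix ring is not commutative
  in general.\<close>

lemma poly_algebra_image_alg_adjoin:
  fixes A :: "'k::field mat"
  assumes A: "A \<in> carrier_mat n n" and m: "m \<noteq> 0"
    "\<And>f. alg_eval (mat_algebra n) f A = 0\<^sub>m n n \<longleftrightarrow> m dvd f"
  shows "poly_algebra_image (alg_adjoin (mat_algebra n) A) (\<lambda>f. alg_eval (mat_algebra n) f A) m"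
proof -
  let ?\<phi> = "\<lambda>f. alg_eval (mat_algebra n) f A"
  let ?R = "alg_adjoin (mat_algebra n) A"
  have "?\<phi> \<in> Ring.ring_hom poly_algebra (mat_algebra n)"
    by (rule ring_hom_memI)
      (simp_all add: poly_algebra_def module_mat_simps alg_eval_closed[OF A] alg_eval_mult[OF A]
        alg_eval_add[OF A] alg_eval_1[OF A])
  then interpret \<phi>: ring_hom_ring poly_algebra "mat_algebra n" ?\<phi>
    by (intro ring_hom_ringI2 ring_mat_algebra cring.axioms(1)[OF cring_poly_algebra])
  have R: "?R = mat_algebra n \<lparr>carrier := ?\<phi> ` carrier poly_algebra\<rparr>"
    by (simp add: alg_adjoin_def poly_algebra_def)
  interpret R: ring ?R unfolding R by (rule \<phi>.img_is_ring)
  have cring: "cring ?R"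
  proof unfold_locales
    fix x y assume "x \<in> carrier ?R" "y \<in> carrier ?R"
    then obtain f g where "x = ?\<phi> f" "y = ?\<phi> g" by (auto simp: alg_adjoin_def)
    then have "x * y = y * x" by (metis alg_eval_mult[OF A] mult.commute)
    then show "x \<otimes>\<^bsub>?R\<^esub> y = y \<otimes>\<^bsub>?R\<^esub> x" by (simp add: alg_adjoin_def module_mat_simps)
  qed
  show ?thesis
    using cring by (intro poly_algebra_image.intro poly_algebra_image_axioms.intro)
      (simp_all add: alg_adjoin_def module_mat_simps alg_eval_mult[OF A]
        alg_eval_add[OF A] alg_eval_1[OF A] alg_eval_smult[OF A] m)
qed

text \<open>Since \<open>0\<close> and \<open>1\<close> are fixed by the Frobenius map, \<open>W u ^ p ^ j\<close> only depends on \<open>j\<close> through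
  the map \<open>g \<mapsto> g ^ p ^ j\<close> of the finite set \<open>G\<close>, so two of these powers of \<open>W u\<close> coincide.\<close>

lemma (in enumerated_comm_group) annihilator_exists:
  fixes u :: "'g \<Rightarrow> 'k::field"
  assumes p: "Factorial_Ring.prime (CHAR('k))" and u: "\<And>x. u x = 0 \<or> u x = 1"
  obtains f where "f \<noteq> 0" "alg_eval (mat_algebra n) f (W u) = 0\<^sub>m n n"
proof -
  let ?q = "\<lambda>j. CHAR('k) ^ j"
  let ?F = "\<lambda>j. restrict (\<lambda>g. g [^] ?q j) (carrier G)"
  have q0: "?q j > 0" for j using prime_gt_0_nat[OF p] by simp
  \<comment> \<open>Restricting to the carrier places the power maps in a finite set of extensional
    functions, so two exponents must give the same map.\<close>
  have "range ?F \<subseteq> carrier G \<rightarrow>\<^sub>E carrier G" by auto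
  then have "finite (range ?F)"
    by (rule finite_subset) (intro finite_PiE finite_carrier)
  then have "\<not> inj ?F" using finite_imageD infinite_UNIV_nat by blast
  then obtain i j where ij: "?F i = ?F j" "i \<noteq> j" by (auto simp: inj_def)
  have eq: "g [^] ?q i = g [^] ?q j" if "g \<in> carrier G" for g
    using fun_cong[OF ij(1), of g] that by simp
  have fix_sum: "(\<Sum>g\<in>X. u g) ^ ?q k = (\<Sum>g\<in>X. u g)" for X k
  proof -
    have "u g ^ ?q k = u g" for g using u[of g] q0[of k] by auto
    then show ?thesis by (simp add: freshmans_dream_sum'[OF p refl])
  qed
  have "W u ^\<^sub>m ?q i = W u ^\<^sub>m ?q j"
    unfolding W_frobenius[OF p refl] fix_sum
    by (simp add: eq cong: conj_cong)
  then have pow: "alg_eval (mat_algebra n) (Polynomial.monom 1 (?q i)) (W u) = alg_eval (mat_algebra n) (Polynomial.monom 1 (?q j)) (W u)"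
  proof -
    have "alg_eval (mat_algebra n) [:0, 1:] (W u) = W u"
      using right_mult_one_mat[OF W_closed[of u]]
      by (simp add: alg_eval_pCons alg_eval_0 zero_smult_mat one_smult_mat left_add_zero_mat[of _ n n] right_mult_zero_mat[of _ n n])
    then have "alg_eval (mat_algebra n) (Polynomial.monom 1 k) (W u) = W u ^\<^sub>m k" for k
      using alg_eval_power[OF W_closed, of "[:0, 1:]" k u] by (simp add: monom_altdef)
    then show ?thesis using \<open>W u ^\<^sub>m ?q i = W u ^\<^sub>m ?q j\<close> by simp
  qed
  show thesis
  proof
    show "Polynomial.monom 1 (?q i) + Polynomial.smult (-1) (Polynomial.monom 1 (?q j)) \<noteq> (0 :: 'k poly)"
    proof
      assume "Polynomial.monom 1 (?q i) + Polynomial.smult (-1) (Polynomial.monom 1 (?q j)) = (0 :: 'k poly)"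
      then have "Polynomial.monom 1 (?q i) = (Polynomial.monom 1 (?q j) :: 'k poly)" by simp
      then have "?q i = ?q j" by (metis degree_monom_eq one_neq_zero)
      then show False using ij(2) prime_gt_1_nat[OF p] by simp
    qed
    show "alg_eval (mat_algebra n) (Polynomial.monom 1 (?q i) + Polynomial.smult (-1) (Polynomial.monom 1 (?q j))) (W u) = 0\<^sub>m n n"
      unfolding alg_eval_add[OF W_closed] alg_eval_smult[OF W_closed] pow
      by (rule eq_matI) (use alg_eval_closed[OF W_closed, of "Polynomial.monom 1 (?q j)" u] in auto)
  qed
qed

text \<open>Both conditions concern \<open>g \<otimes> inv h\<close>. If its power is trivial, its
  coset has order dividing both \<open>p ^ j\<close> and the coprime number \<open>M\<close>, so it
  lies in \<open>P\<close>. Conversely, elements of \<open>P\<close> are killed by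
  \<open>p ^ a\<close>, hence by \<open>p ^ j\<close>.\<close>

lemma (in comm_group) sylow_quotient_fibres:
  assumes fin: "finite (carrier G)" and P: "subgroup P G" "card P = p ^ a"
    and M: "order (G Mod P) = M" "\<not> p dvd M" and p: "Factorial_Ring.prime p" and j: "a \<le> j"
    and g: "g \<in> carrier G" and h: "h \<in> carrier G"
  shows "g [^] (p ^ j) = h [^] (p ^ j) \<longleftrightarrow> P #> g = P #> h"
proof -
  interpret P: normal P G using P(1) by (rule subgroup_imp_normal)
  interpret Q: group "G Mod P" by (rule P.factorgroup_is_group)
  interpret \<pi>: group_hom G "G Mod P" "\<lambda>x. P #> x"
    by unfold_locales (rule P.r_coset_hom_Mod)
  let ?x = "g \<otimes> inv h"
  have x: "?x \<in> carrier G" using g h by simp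
  have "g [^] (p ^ j) = h [^] (p ^ j) \<longleftrightarrow> ?x [^] (p ^ j) = \<one>"
    using g h by (simp add: pow_mult_distrib m_comm nat_pow_inv) (metis inv_solve_right' nat_pow_closed l_one one_closed)
  also have "\<dots> \<longleftrightarrow> ?x \<in> P"
  proof
    assume "?x [^] (p ^ j) = \<one>"
    then have "(P #> ?x) [^]\<^bsub>G Mod P\<^esub> (p ^ j) = \<one>\<^bsub>G Mod P\<^esub>"
      using x \<pi>.hom_nat_pow[OF x, of "p ^ j"] \<pi>.hom_one by simp
    then have "group.ord (G Mod P) (P #> ?x) dvd p ^ j"
      using Q.pow_eq_id \<pi>.hom_closed[OF x] by blast
    moreover have "group.ord (G Mod P) (P #> ?x) dvd M"
      using Q.ord_dvd_group_order[OF \<pi>.hom_closed[OF x]] M by simp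
    moreover have "coprime (p ^ j) M" using p M by (simp add: prime_imp_coprime)
    ultimately have "group.ord (G Mod P) (P #> ?x) = 1"
      using coprime_common_divisor_nat by blast
    then have "P #> ?x = \<one>\<^bsub>G Mod P\<^esub>"
      using Q.ord_eq_1[OF \<pi>.hom_closed[OF x]] by simp
    then show "?x \<in> P" using rcos_self[OF x P(1)] by (simp add: FactGroup_def)
  next
    assume "?x \<in> P"
    interpret K: group "G\<lparr>carrier := P\<rparr>" by (rule P.subgroup_is_group) (rule is_group)
    have "?x [^]\<^bsub>G\<lparr>carrier := P\<rparr>\<^esub> order (G\<lparr>carrier := P\<rparr>) = \<one>\<^bsub>G\<lparr>carrier := P\<rparr>\<^esub>"
      by (rule K.pow_order_eq_1) (simp add: \<open>?x \<in> P\<close>)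
    then have "?x [^] (p ^ a) = \<one>"
      using P(2) by (simp add: order_def flip: nat_pow_consistent)
    then have "?x [^] (p ^ a * p ^ (j - a)) = \<one>"
      using x by (simp flip: nat_pow_pow)
    then show "?x [^] (p ^ j) = \<one>" using j by (simp flip: power_add)
  qed
  also have "\<dots> \<longleftrightarrow> P #> g = P #> h"
    using P.rcos_module[OF is_group h g] repr_independence[of g P h] rcos_self[of g P] g h P(1)
    by auto
  finally show ?thesis .
qed

theorem proposition14p4:
  fixes G :: "('g, 'm) monoid_scheme" (structure)
    and S P :: "'g set"
    and e :: "nat \<Rightarrow> 'g" and e' :: "nat \<Rightarrow> 'g set"
    and p a M N :: nat
    and A :: "'k::field mat" and m :: "'k poly"
  assumes "comm_group G" and "finite (carrier G)" and "order G = N"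
    and "S \<subseteq> carrier G - {\<one>}" and "m_inv G ` S = S"
    and "CHAR('k) = p" and "p dvd N" and "N = p ^ a * M" and "\<not> p dvd M"
    and "subgroup P G" and "card P = p ^ a"
    and "bij_betw e {..<N} (carrier G)"
    and "bij_betw e' {..<M} (carrier (G Mod P))"
    and "A = cayley_adj_mat G N e S" and "m = min_poly_mat N A"
  shows "alg_isomorphic
           (alg_quotient (cayley_algebra G N e S :: ('k, 'k mat) module)
             (jacobson_radical (cayley_algebra G N e S :: ('k, 'k mat) module)))
           (alg_quotient poly_algebra (PIdl\<^bsub>poly_algebra\<^esub> (squarefree_part m)))
         \<and> squarefree_part m =
             min_poly_mat M
               (weighted_cayley_mat (G Mod P) M e' (\<lambda>x. of_nat (coset_weight G P S x)))"
proof -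
  interpret comm_group G by fact
  interpret P: normal P G using \<open>subgroup P G\<close> by (rule subgroup_imp_normal)
  interpret Q: comm_group "G Mod P" using \<open>subgroup P G\<close> by (rule abelian_FactGroup)
  \<comment> \<open>Excludes characteristic 0, since 0 divides only 0; a nonzero characteristic of a
    field is prime.\<close>
  have "N > 0" using assms(2,3) order_gt_0_iff_finite by blast
  then have "p \<noteq> 0" using \<open>p dvd N\<close> by auto
  then have p: "Factorial_Ring.prime (CHAR('k))" using \<open>CHAR('k) = p\<close> prime_CHAR_semidom by auto
  interpret E: enumerated_group_epi G N e "G Mod P" M e' "\<lambda>x. P #> x"
  proof unfold_locales
    show "(\<lambda>x. P #> x) ` carrier G = carrier (G Mod P)"
      by (auto simp: FactGroup_def RCOSETS_def)
  qed (use assms P.r_coset_hom_Mod in auto)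
  \<comment> \<open>The connection set as an element of K[G]: the sum of the elements of
    \<open>S\<close>.\<close>
  define u :: "'g \<Rightarrow> 'k" where "u x = (if x \<in> S then 1 else 0)" for x
  have A: "A = E.G.W u" unfolding \<open>A = _\<close> cayley_adj_mat_def weighted_cayley_mat_def u_def ..
  have "order (G Mod P) = M"
    using bij_betw_same_card[OF assms(13)] by (simp add: order_def)
  then have fibres: "g [^] (CHAR('k) ^ j) = h [^] (CHAR('k) ^ j) \<longleftrightarrow> P #> g = P #> h"
    if "a \<le> j" "g \<in> carrier G" "h \<in> carrier G" for j g h
    using sylow_quotient_fibres that assms p by blast
  \<comment> \<open>Summing the indicator function of \<open>S\<close> over a coset counts the
    elements of \<open>S\<close> lying in it.\<close>
  have weight: "weighted_cayley_mat (G Mod P) M e' (\<lambda>x. of_nat (coset_weight G P S x)) = E.H.W (E.push u)"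
    unfolding E.H.W_eq_iff
  proof
    fix y
    have "of_nat (coset_weight G P S y) = (\<Sum>s | s \<in> S \<and> P #> s = y. 1 :: 'k)"
      by (simp add: coset_weight_def)
    also have "\<dots> = E.push u y"
      unfolding E.push_def
      by (rule sum.mono_neutral_cong_left) (use assms in \<open>auto simp: u_def\<close>)
    finally show "of_nat (coset_weight G P S y) = E.push u y" .
  qed
  \<comment> \<open>A nonzero annihilator guarantees that \<open>m\<close> is the monic generator of
    the annihilator ideal, so the description in \<open>min_poly_mat\<close> has a unique
    solution.\<close>
  obtain f where "f \<noteq> 0" "alg_eval (mat_algebra N) f A = 0\<^sub>m N N"
    unfolding A by (rule E.G.annihilator_exists[OF p, of u]) (auto simp: u_def)
  then obtain d where d: "lead_coeff d = 1" "\<And>f. alg_eval (mat_algebra N) f A = 0\<^sub>m N N \<longleftrightarrow> d dvd f"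
    using annihilator_principal A E.G.W_closed by metis
  have "m = d" unfolding \<open>m = _\<close> using d by (rule min_poly_mat_eqI)
  then have m: "m \<noteq> 0" "\<And>f. alg_eval (mat_algebra N) f A = 0\<^sub>m N N \<longleftrightarrow> m dvd f"
    using d by auto
  have "poly_algebra_image (cayley_algebra G N e S) (\<lambda>f. alg_eval (mat_algebra N) f A) m"
    unfolding cayley_algebra_def \<open>A = cayley_adj_mat G N e S\<close>[symmetric]
    using m A by (intro poly_algebra_image_alg_adjoin) auto
  then show ?thesis
    using poly_algebra_image.alg_isomorphic_quotient E.min_poly_push[OF p fibres m[unfolded A]] weight
    by metis
qed

end
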